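(* Let $\alpha\in[1/2,1)$. As $s\to\infty$, the variance $\sigma_Q^2$ of the stationary congestion level satisfies $$\sigma_Q^2=\frac{\gamma\,\sigma_X}{\pi}\sqrt{\frac{2}{\mu_X}}\;s^{3/2-\alpha}\,G_3(d(s))\,\bigl(1+O(s^{\alpha-1})\bigr),$$ where $d(s)=\sqrt{s^{1-2\alpha}\gamma^2\mu_X/(2\sigma_X^2)}$ and, for $b>0$, $$G_3(b)=\int_0^{\infty}\frac{t^2}{(b^2+t^2)^2}\,\frac{\exp(-b^2-t^2)}{1-\exp(-b^2-t^2)}\,dt.$$
   Context: Let $X$ be a non-negative integer-valued random variable with mean $\mu_X>0$, variance $\sigma_X^2$ and probability generating function $X(z)=\sum_{j\ge 0}\mathbb{P}(X=j)z^j$, whose radius of convergence is $r>1$, and such that $|X(z)|<X(r_1)$ for all $z$ with $|z|=r_1$, $z\ne r_1$, and any $r_1\in(0,r)$. For positive integers $n,s$ the demand per period $A(k)$, $k=1,2,\dots$, is a sequence of i.i.d. random variables, each distributed as $A=X_1+\dots+X_n$, the sum of $n$ i.i.d. copies of $X$. The congestion process is the Markov chain $Q_0=0$, $Q_{k+1}=\max\{Q_k+A(k)-s,0\}$. It is assumed that $0<n\mu_X<s$ and that $\mathbb{P}(A=j)>0$ for some $j>s$. Let $Q$ have the stationary distribution of this chain and let $\sigma_Q^2=\mathrm{Var}(Q)$. The system is scaled so that, along a sequence $s\to\infty$ with $n=n(s)$, $X$ fixed and $\alpha$ fixed, $$\rho_s=\frac{n\mu_X}{s}=1-\frac{\gamma}{s^{\alpha}},$$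 with $\gamma>0$ (possibly depending on $s$) bounded away from $0$ and $\infty$ as $s\to\infty$. *)

theory Defs
  imports "HOL-Probability.Probability"
begin

definition pgf :: "nat pmf \<Rightarrow> 'a::{real_normed_field, banach} \<Rightarrow> 'a" where
  "pgf X z = (\<Sum>j. of_real (pmf X j) * z ^ j)"

definition pgf_radius :: "nat pmf \<Rightarrow> ereal" where
  "pgf_radius X = conv_radius (\<lambda>j. pmf X j)"

definition mean :: "nat pmf \<Rightarrow> real" where
  "mean X = measure_pmf.expectation X real"

definition var :: "nat pmf \<Rightarrow> real" where
  "var X = measure_pmf.variance X real"

definition demand :: "nat pmf \<Rightarrow> nat \<Rightarrow> nat pmf" where
  "demand X n = map_pmf sum_list (replicate_pmf n X)"

(* Transition kernel of Q(k+1) = max {Q(k) + A(k) - s, 0}: the demand A(k) is drawn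
   independently of the current state q. *)
definition congestion_kernel :: "nat pmf \<Rightarrow> nat \<Rightarrow> nat \<Rightarrow> nat \<Rightarrow> nat pmf" where
  "congestion_kernel X n s q =
     map_pmf (\<lambda>a. nat (max (int q + int a - int s) 0)) (demand X n)"

definition stationary_distribution :: "('a \<Rightarrow> 'a pmf) \<Rightarrow> 'a pmf \<Rightarrow> bool" where
  "stationary_distribution K Q \<longleftrightarrow> bind_pmf Q K = Q"

definition G3 :: "real \<Rightarrow> real" where
  "G3 b = (LBINT t:{0..}. t\<^sup>2 / (b\<^sup>2 + t\<^sup>2)\<^sup>2 *
             (exp (- b\<^sup>2 - t\<^sup>2) / (1 - exp (- b\<^sup>2 - t\<^sup>2))))"

end

theory Submission
  imports Defs "HOL-Complex_Analysis.Complex_Analysis"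
begin

text \<open>
  The proof goes through an exact formula for the variance, followed by a comparison of two integrals.

  \<^emph>\<open>Exact formula.\<close> Let \<open>A\<close> be the demand per period and \<open>S\<^sub>l\<close> the net input over \<open>l\<close> periods, the sum of
  \<open>l\<close> independent copies of \<open>A - s\<close>. On an annulus \<open>1 < r0 \<le> |z| \<le> r1\<close> on which \<open>G z = A(z) / z^s\<close> has
  modulus below 1, the function \<open>- Ln (1 - G z)\<close> is the Laurent series whose \<open>j\<close>-th coefficient is
  \<open>c\<^sub>j = \<Sum>\<^sub>l P(S\<^sub>l = j) / l\<close>. It splits into its part \<open>h_up\<close> with \<open>j \<ge> 0\<close>, holomorphic in \<open>|z| < r1\<close>, and its
  part with \<open>j < 0\<close>, holomorphic in \<open>|z| > r0\<close>. Stationarity says that \<open>Q(z) (1 - G z)\<close> is a polynomial in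
  \<open>1 / z\<close>, so \<open>Q(z) exp (- h_up z)\<close> continues to a bounded entire function, which Liouville's theorem makes
  constant. Hence \<open>Q(z)\<close> is a multiple of \<open>exp (h_up z)\<close> and \<open>Var Q = \<Sum>\<^sub>j j\<^sup>2 c\<^sub>j\<close>, summed over \<open>j > 0\<close>. Since
  \<open>\<Sum>\<^sub>j j\<^sup>2 z^(-j) = z (z + 1) / (z - 1)^3\<close>, this is the mean of \<open>- Ln (1 - G z) \<cdot> z (z + 1) / (z - 1)^3\<close> over a
  circle in the annulus (\<open>wiener_hopf_factorization\<close>, \<open>variance_contour_integral\<close>).

  \<^emph>\<open>Gaussian comparison.\<close> Take the circle \<open>z = exp w\<close>, \<open>w = \<theta> + \<i> u\<close>, with \<open>\<theta> = (\<mu> / \<sigma>\<^sup>2) (1 - \<rho>)\<close>, to first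
  order the saddle point of \<open>G\<close>. With \<open>a = s \<sigma>\<^sup>2 / (2 \<mu>)\<close> the second-order expansion of \<open>log X(exp w)\<close> gives
  \<open>G z \<approx> exp (- a (\<theta>\<^sup>2 + u\<^sup>2))\<close>, and \<open>z (z + 1) / (z - 1)^3 = 2 / w^3 + O(1)\<close>. For the two approximants the integral
  over the whole line is computed by parts: it is \<open>8 \<theta> a \<surd>a G3 (\<theta> \<surd>a)\<close> (\<open>gaussian_main_term\<close>), where
  \<open>\<theta> \<surd>a = d\<close>, and division by \<open>2 \<pi>\<close> gives the leading term of the theorem.

  \<^emph>\<open>Error.\<close> The exact and the approximate integrand differ by at most a constant times \<open>1 / (\<theta>\<^sup>2 + u\<^sup>2)\<close>,
  uniformly in \<open>n\<close>, \<open>s\<close> and \<open>u\<close>, so the variance and the leading term differ by \<open>O(1 / \<theta>)\<close>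
  (\<open>uniform_heavy_traffic\<close>). As long as \<open>d\<close> stays bounded, \<open>G3 d\<close> is at least a constant times \<open>1 / d^3\<close>
  (\<open>G3_lower_bound\<close>), so the leading term is at least a constant times \<open>1 / \<theta>\<^sup>2\<close>. The relative error is therefore
  \<open>O(\<theta>) = O(s^(-\<alpha>))\<close>, which is \<open>O(s^(\<alpha>-1))\<close> because \<open>\<alpha> \<ge> 1/2\<close>.
\<close>

section \<open>Probability generating functions\<close>

text \<open>Every expectation below is read as a series, so that it can be compared with the coefficients of a
generating function.\<close>

lemma expectation_nat_pmf_sums:
  fixes f :: "nat \<Rightarrow> 'b::{banach, second_countable_topology}"
  assumes "summable (\<lambda>k. pmf p k * norm (f k))"
  shows "integrable (measure_pmf p) f"
    and "(\<lambda>k. pmf p k *\<^sub>R f k) sums measure_pmf.expectation p f"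
proof -
  have *: "integrable (count_space UNIV) (\<lambda>k. pmf p k *\<^sub>R f k)"
    using assms by (simp add: integrable_count_space_nat_iff)
  show "integrable (measure_pmf p) f"
    unfolding measure_pmf_eq_density using * by (subst integrable_density) auto
  have "measure_pmf.expectation p f = (\<integral>k. pmf p k *\<^sub>R f k \<partial>count_space UNIV)"
    unfolding measure_pmf_eq_density by (subst integral_density) auto
  thus "(\<lambda>k. pmf p k *\<^sub>R f k) sums measure_pmf.expectation p f"
    using sums_integral_count_space_nat[OF *] by simp
qed


lemma pgf_summable:
  fixes z :: "'a::{real_normed_field, banach}"
  assumes "summable (\<lambda>j. pmf p j * r ^ j)" "norm z \<le> r"
  shows "summable (\<lambda>j. norm (of_real (pmf p j) * z ^ j))"
    and "(\<lambda>j. of_real (pmf p j) * z ^ j) sums pgf p z"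
    and "norm (pgf p z) \<le> pgf p r"
proof -
  have r: "r \<ge> 0" using assms(2) norm_ge_zero[of z] by linarith
  have le: "norm (of_real (pmf p j) * z ^ j) \<le> pmf p j * r ^ j" for j
    using assms(2) by (auto simp: norm_mult norm_power intro!: mult_left_mono power_mono)
  show 1: "summable (\<lambda>j. norm (of_real (pmf p j) * z ^ j))"
    by (rule summable_comparison_test[OF _ assms(1)]) (use le in auto)
  show "(\<lambda>j. of_real (pmf p j) * z ^ j) sums pgf p z"
    using summable_norm_cancel[OF 1] unfolding pgf_def by (rule summable_sums)
  have "norm (pgf p z) \<le> (\<Sum>j. norm (of_real (pmf p j) * z ^ j))"
    unfolding pgf_def by (rule summable_norm[OF 1])
  also have "\<dots> \<le> pgf p r"
    unfolding pgf_def using suminf_le[OF le 1 assms(1)] by simp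
  finally show "norm (pgf p z) \<le> pgf p r" .
qed

lemma pgf_of_real:
  assumes "summable (\<lambda>j. pmf p j * r ^ j)" "0 \<le> x" "x \<le> r"
  shows "pgf p (complex_of_real x) = complex_of_real (pgf p x)"
proof -
  have "(\<lambda>j. pmf p j * x ^ j) sums pgf p x"
    using pgf_summable(2)[OF assms(1), of x] assms by simp
  hence "(\<lambda>j. complex_of_real (pmf p j * x ^ j)) sums complex_of_real (pgf p x)"
    by (subst sums_of_real_iff)
  thus ?thesis unfolding pgf_def[of p "complex_of_real x"] by (simp add: sums_iff)
qed

lemma summable_pmf_nat: "summable (pmf p)" "suminf (pmf p) = 1" for p :: "nat pmf"
proof -
  have "summable (\<lambda>k. norm (pmf p k))"
    using integrable_pmf[of UNIV p] unfolding integrable_count_space_nat_iff .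
  hence "(\<lambda>k. pmf p k *\<^sub>R (1::real)) sums measure_pmf.expectation p (\<lambda>_. 1)"
    by (intro expectation_nat_pmf_sums) simp
  thus "summable (pmf p)" "suminf (pmf p) = 1" by (simp_all add: sums_iff)
qed

lemma pgf_1 [simp]: "pgf p (1 :: 'a :: {real_normed_field, banach}) = 1"
  using summable_pmf_nat[of p] unfolding pgf_def
  by (simp flip: suminf_of_real)

lemma power_series_holomorphic:
  fixes a :: "nat \<Rightarrow> complex"
  assumes "summable (\<lambda>j. a j * of_real r ^ j)"
  shows "(\<lambda>z. \<Sum>j. a j * z ^ j) holomorphic_on ball 0 r"
proof (cases "r > 0")
  case True
  have R: "fps_conv_radius (Abs_fps a) \<ge> ereal r"
    using conv_radius_geI[OF assms] True by (simp add: fps_conv_radius_def)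
  have "eval_fps (Abs_fps a) holomorphic_on ball 0 r"
  proof (rule holomorphic_on_eval_fps, rule subsetI)
    fix x :: complex assume "x \<in> ball 0 r"
    hence "ereal (norm x) < ereal r" by simp
    hence "ereal (norm x) < fps_conv_radius (Abs_fps a)" using R by (rule less_le_trans)
    thus "x \<in> eball 0 (fps_conv_radius (Abs_fps a))" by simp
  qed
  thus ?thesis by (simp add: eval_fps_def[abs_def])
qed (simp add: ball_empty holomorphic_on_def)

lemma pgf_holomorphic:
  assumes "summable (\<lambda>j. pmf p j * r ^ j)"
  shows "pgf p holomorphic_on ball (0::complex) r"
proof (cases "r > 0")
  case True
  have "summable (\<lambda>j. complex_of_real (pmf p j) * of_real r ^ j)"
    using pgf_summable(2)[OF assms, of "complex_of_real r"] True by (simp add: sums_iff)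
  from power_series_holomorphic[OF this] show ?thesis by (simp add: pgf_def[abs_def])
qed (simp add: ball_empty holomorphic_on_def)

text \<open>The first two factorial moments are the derivatives of the generating function at 1. A radius of
convergence above 1 places 1 in the interior of the disc, so the series may be differentiated termwise there.\<close>

lemma pgf_moments:
  assumes "summable (\<lambda>j. pmf p j * r ^ j)" "r > 1"
  defines "P \<equiv> (pgf p :: complex \<Rightarrow> complex)"
  shows "deriv P 1 = of_real (mean p)"
    and "deriv (deriv P) 1 = of_real (var p + (mean p)\<^sup>2 - mean p)"
    and "integrable (measure_pmf p) (\<lambda>k. (real k)\<^sup>2)"
proof -
  define F where "F = Abs_fps (\<lambda>k. complex_of_real (pmf p k))"
  have "summable (\<lambda>j. complex_of_real (pmf p j) * of_real r ^ j)"
    using pgf_summable(2)[OF assms(1), of "complex_of_real r"] assms(2) by (simp add: sums_iff)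
  from conv_radius_geI[OF this] have R: "fps_conv_radius F \<ge> ereal r"
    using assms(2) by (simp add: fps_conv_radius_def F_def)
  have P: "P = eval_fps F" by (auto simp: eval_fps_def pgf_def F_def P_def)
  have R1: "fps_conv_radius (fps_deriv F) \<ge> ereal r"
    using R fps_conv_radius_deriv[of F] by (rule order.trans)
  have R2: "fps_conv_radius (fps_deriv (fps_deriv F)) \<ge> ereal r"
    using R1 fps_conv_radius_deriv[of "fps_deriv F"] by (rule order.trans)
  have R': "1 < fps_conv_radius F" "1 < fps_conv_radius (fps_deriv F)"
     "1 < fps_conv_radius (fps_deriv (fps_deriv F))"
    using R R1 R2 assms(2) by (auto intro: less_le_trans[of _ "ereal r"])
  have d1: "deriv P z = eval_fps (fps_deriv F) z" if "z \<in> ball 0 r" for z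
  proof -
    have "ereal (norm z) < ereal r" using that by simp
    hence "ereal (norm z) < fps_conv_radius F" using R by (rule less_le_trans)
    thus ?thesis unfolding P by (intro DERIV_imp_deriv has_field_derivative_eval_fps)
  qed
  have d2: "deriv (deriv P) 1 = eval_fps (fps_deriv (fps_deriv F)) 1"
  proof -
    have "deriv (deriv P) 1 = deriv (eval_fps (fps_deriv F)) 1"
      using assms(2) d1 by (intro deriv_cong_ev refl eventually_nhds_in_open[THEN eventually_mono, of "ball 0 r"]) auto
    also have "\<dots> = eval_fps (fps_deriv (fps_deriv F)) 1"
      by (intro DERIV_imp_deriv has_field_derivative_eval_fps) (use R' in \<open>simp flip: one_ereal_def\<close>)
    finally show ?thesis .
  qed
  have s1: "(\<lambda>k. complex_of_real (pmf p (Suc k) * real (Suc k))) sums deriv P 1"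
    using sums_eval_fps[of 1 "fps_deriv F"] R' assms(2)
    by (simp add: d1 F_def mult_ac flip: one_ereal_def)
  have "summable (\<lambda>k. pmf p (Suc k) * real (Suc k))"
    using s1 by (auto simp: sums_iff simp del: of_real_mult simp flip: summable_complex_of_real)
  hence sm1: "summable (\<lambda>k. pmf p k * real k)" by (subst (asm) summable_Suc_iff)
  have m1: "integrable (measure_pmf p) real" "(\<lambda>k. pmf p k * real k) sums mean p"
    using expectation_nat_pmf_sums[of p real] sm1 by (simp_all add: mean_def)
  have "(\<lambda>k. complex_of_real (pmf p (Suc k) * real (Suc k))) sums complex_of_real (mean p)"
    using m1(2) by (subst sums_of_real_iff, subst sums_Suc_iff) auto
  thus eq1: "deriv P 1 = of_real (mean p)" using s1 sums_unique2 by blast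
  define f2 where "f2 = (\<lambda>k. real k * (real k - 1))"
  have s2: "(\<lambda>k. complex_of_real (pmf p (k+2) * f2 (k+2))) sums deriv (deriv P) 1"
    using sums_eval_fps[of 1 "fps_deriv (fps_deriv F)"] R'
    by (simp add: d2 F_def mult_ac f2_def add_ac flip: one_ereal_def)
  have "summable (\<lambda>k. pmf p (k+2) * f2 (k+2))"
    using s2 by (auto simp: sums_iff simp del: of_real_mult simp flip: summable_complex_of_real)
  hence sm2: "summable (\<lambda>k. pmf p k * f2 k)" by (subst (asm) summable_iff_shift)
  have f2pos: "f2 k \<ge> 0" for k by (cases k) (auto simp: f2_def)
  have m2: "integrable (measure_pmf p) f2" "(\<lambda>k. pmf p k * f2 k) sums measure_pmf.expectation p f2"
    using expectation_nat_pmf_sums[of p f2] sm2 f2pos by (simp_all add: mean_def)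
  have z: "(\<Sum>i<2. pmf p i * f2 i) = 0" by (simp add: f2_def numeral_2_eq_2)
  have "(\<lambda>k. complex_of_real (pmf p (k+2) * f2 (k+2))) sums complex_of_real (measure_pmf.expectation p f2)"
    using m2(2) sums_iff_shift[of "\<lambda>k. pmf p k * f2 k" 2 "measure_pmf.expectation p f2"] z
    by (subst sums_of_real_iff) (simp)
  hence eq2: "deriv (deriv P) 1 = of_real (measure_pmf.expectation p f2)" using s2 sums_unique2 by blast
  have sq: "(\<lambda>k. (real k)\<^sup>2) = (\<lambda>k. f2 k + real k)"
    by (auto simp: f2_def power2_eq_square algebra_simps)
  have int_sq: "integrable (measure_pmf p) (\<lambda>k. (real k)\<^sup>2)"
    unfolding sq using m1 m2 by (intro Bochner_Integration.integrable_add)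
  thus "integrable (measure_pmf p) (\<lambda>k. (real k)\<^sup>2)" .
  have "var p = measure_pmf.expectation p (\<lambda>k. (real k)\<^sup>2) - (mean p)\<^sup>2"
    unfolding var_def mean_def by (rule measure_pmf.variance_eq[OF m1(1) int_sq])
  also have "measure_pmf.expectation p (\<lambda>k. (real k)\<^sup>2) = measure_pmf.expectation p f2 + mean p"
    unfolding sq mean_def using m1 m2 by (intro Bochner_Integration.integral_add)
  finally show "deriv (deriv P) 1 = of_real (var p + (mean p)\<^sup>2 - mean p)" using eq2 by simp
qed

lemma pmf_sum_pair:
  "pmf (map_pmf (\<lambda>(x, y). x + y) (pair_pmf p q)) k = (\<Sum>i\<le>k. pmf p i * pmf q (k - i))"
  for p q :: "nat pmf"
proof -
  have "pmf (map_pmf (\<lambda>(x, y). x + y) (pair_pmf p q)) k =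
          measure (measure_pmf (pair_pmf p q)) ((\<lambda>(x, y). x + y) -` {k})"
    by (simp add: pmf_map)
  also have "(\<lambda>(x, y). x + y) -` {k} = (\<lambda>i. (i, k - i)) ` {..k}"
    by (auto simp: image_iff)
  also have "measure (measure_pmf (pair_pmf p q)) \<dots> = (\<Sum>i\<le>k. pmf p i * pmf q (k - i))"
    by (subst measure_measure_pmf_finite) (auto simp: sum.reindex inj_on_def pmf_pair)
  finally show ?thesis .
qed

lemma pgf_sum_pair:
  fixes p q :: "nat pmf"
  defines "t \<equiv> map_pmf (\<lambda>(x, y). x + y) (pair_pmf p q)"
  assumes "summable (\<lambda>j. pmf p j * r ^ j)" "summable (\<lambda>j. pmf q j * r ^ j)" "r \<ge> 0"
  shows "summable (\<lambda>j. pmf t j * r ^ j)"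
    and "norm (z :: 'a :: {real_normed_field, banach}) \<le> r \<Longrightarrow> pgf t z = pgf p z * pgf q z"
proof -
  have eq: "of_real (pmf t k) * z ^ k =
      (\<Sum>i\<le>k. (of_real (pmf p i) * z ^ i) * (of_real (pmf q (k - i)) * z ^ (k - i)))"
    for k and z :: "'b :: {real_normed_field, banach}"
  proof -
    have "(\<Sum>i\<le>k. (of_real (pmf p i) * z ^ i) * (of_real (pmf q (k - i)) * z ^ (k - i))) =
          (\<Sum>i\<le>k. of_real (pmf p i * pmf q (k - i)) * z ^ k)"
    proof (rule sum.cong)
      fix i assume "i \<in> {..k}"
      hence "z ^ k = z ^ i * z ^ (k - i)" by (simp flip: power_add)
      thus "(of_real (pmf p i) * z ^ i) * (of_real (pmf q (k - i)) * z ^ (k - i)) =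
            of_real (pmf p i * pmf q (k - i)) * z ^ k" by simp
    qed auto
    thus ?thesis by (simp add: t_def pmf_sum_pair sum_distrib_right)
  qed
  have sums: "(\<lambda>k. of_real (pmf t k) * z ^ k) sums (pgf p z * pgf q z)" if "norm z \<le> r"
    for z :: "'b :: {real_normed_field, banach}"
    unfolding eq pgf_def
    by (rule Cauchy_product_sums; rule pgf_summable) (use assms that in auto)
  show "norm (z :: 'a) \<le> r \<Longrightarrow> pgf t z = pgf p z * pgf q z"
    using sums[of z] by (simp add: pgf_def sums_iff)
  show "summable (\<lambda>j. pmf t j * r ^ j)"
    using sums[of r] assms(4) by (simp add: sums_iff)
qed

lemma demand_0: "demand X 0 = return_pmf 0"
  by (simp add: demand_def)

lemma demand_Suc:
  "demand X (Suc n) = map_pmf (\<lambda>(x, y). x + y) (pair_pmf X (demand X n))"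
  unfolding demand_def
  by (simp add: map_pmf_def pair_pmf_def bind_assoc_pmf bind_return_pmf)

lemma pgf_demand:
  assumes "summable (\<lambda>j. pmf X j * r ^ j)" "r \<ge> 0"
  shows "summable (\<lambda>j. pmf (demand X n) j * r ^ j)"
    and "norm (z :: 'a :: {real_normed_field, banach}) \<le> r \<Longrightarrow> pgf (demand X n) z = pgf X z ^ n"
proof (induction n)
  case 0
  have *: "(\<lambda>j. of_real (pmf (return_pmf 0) j) * z ^ j) = (\<lambda>j. if j = 0 then 1 else (0::'b))"
    for z :: "'b :: {real_normed_field, banach}" by (auto simp: fun_eq_iff indicator_def)
  { case 1 show ?case using *[of r] by (simp add: demand_0) next
    case 2 show ?case unfolding demand_0 pgf_def * using sums_single[of 0 "\<lambda>_. 1 :: 'a"] by (simp add: sums_iff) }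
next
  case (Suc n)
  { case 1 show ?case unfolding demand_Suc by (rule pgf_sum_pair) (use assms Suc in auto) next
    case 2 thus ?case unfolding demand_Suc using pgf_sum_pair(2)[OF assms(1) Suc(1) assms(2), of z] Suc by simp }
qed

text \<open>If the variance vanished, \<open>X\<close> would be almost surely equal to some \<open>c\<close>, and its generating function \<open>z^c\<close>
would have modulus 1 at \<open>-1\<close>.\<close>

lemma variance_pos:
  fixes X :: "nat pmf"
  assumes X: "summable (\<lambda>j. pmf X j * R ^ j)" "R > 1"
    and circle: "norm (pgf X (- 1 :: complex)) < 1"
  shows "var X > 0"
proof (rule ccontr)
  assume "\<not> var X > 0"
  moreover have "var X \<ge> 0" unfolding var_def by (rule measure_pmf.variance_positive)
  ultimately have "var X = 0" by linarith
  hence v0: "measure_pmf.expectation X (\<lambda>k. (real k - mean X)\<^sup>2) = 0"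
    by (simp add: var_def mean_def)
  have i2: "integrable (measure_pmf X) (\<lambda>k. (real k)\<^sup>2)" by (rule pgf_moments(3)[OF X])
  have i1: "integrable (measure_pmf X) real"
    by (rule measure_pmf.square_integrable_imp_integrable[OF _ i2]) simp
  have "integrable (measure_pmf X) (\<lambda>k. (real k)\<^sup>2 + (mean X)\<^sup>2 - 2 * real k * mean X)"
    by (intro Bochner_Integration.integrable_diff Bochner_Integration.integrable_add i2
          integrable_mult_left integrable_mult_right i1) simp
  hence i: "integrable (measure_pmf X) (\<lambda>k. (real k - mean X)\<^sup>2)" by (simp add: power2_diff)
  have "AE k in measure_pmf X. (real k - mean X)\<^sup>2 = 0"
    using v0 by (subst (asm) integral_nonneg_eq_0_iff_AE[OF i]) auto
  hence eq: "real k = mean X" if "k \<in> set_pmf X" for k using that by (auto simp: AE_measure_pmf_iff)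
  obtain c where c: "c \<in> set_pmf X" using set_pmf_not_empty[of X] by blast
  have "set_pmf X \<subseteq> {c}" using eq c by (metis insertI1 of_nat_eq_iff singletonD subsetI)
  hence "X = return_pmf c" by (simp add: set_pmf_subset_singleton)
  hence "pgf X (- 1 :: complex) = (\<Sum>j. if j = c then (- 1) ^ c else 0)"
    unfolding pgf_def by (intro suminf_cong) (auto simp: indicator_def)
  also have "\<dots> = (- 1) ^ c" using sums_single[of c "\<lambda>_. (- 1 :: complex) ^ c"] by (simp add: sums_iff)
  finally show False using circle by (simp add: norm_power)
qed

section \<open>Exponential moments of the stationary congestion\<close>

text \<open>Truncated subtraction on the natural numbers is the reflection at 0: the stationary law is a fixed point of the
Lindley recursion \<open>Q = (Q + A - s)\<^sup>+\<close> with \<open>A\<close> independent of \<open>Q\<close>.\<close>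

lemma stationary_congestion_lindley:
  assumes "stationary_distribution (congestion_kernel X n s) Q"
  shows "Q = map_pmf (\<lambda>b. b - s) (map_pmf (\<lambda>(q, a). q + a) (pair_pmf Q (demand X n)))"
proof -
  have "congestion_kernel X n s q = map_pmf (\<lambda>a. q + a - s) (demand X n)" for q
    unfolding congestion_kernel_def by (intro map_pmf_cong refl) auto
  with assms have "Q = bind_pmf Q (\<lambda>q. map_pmf (\<lambda>a. q + a - s) (demand X n))"
    by (simp add: stationary_distribution_def cong: bind_pmf_cong)
  also have "\<dots> = map_pmf (\<lambda>b. b - s) (map_pmf (\<lambda>(q, a). q + a) (pair_pmf Q (demand X n)))"
    by (simp add: map_pmf_def pair_pmf_def bind_assoc_pmf bind_return_pmf)
  finally show ?thesis .
qed

text \<open>A Lyapunov argument. With \<open>f q = r^q\<close> and \<open>\<beta> = A(r) / r^s < 1\<close>, one step of the recursion turns \<open>f\<close> into at most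
\<open>\<beta> f + 1\<close> in conditional mean. Since \<open>f\<close> is not known to be integrable, stationarity is applied to the truncation
\<open>min f M\<close>, which yields \<open>E (min f M) \<le> E (min (\<beta> f + 1) M)\<close>. The difference of the two truncations is nonnegative
where \<open>f \<ge> M\<close> and at least \<open>(1 - \<beta>) f - 1\<close> where \<open>f \<le> M\<close>, so the mean of \<open>f\<close> restricted to \<open>f \<le> M\<close> is at most
\<open>1 / (1 - \<beta>)\<close> for every \<open>M\<close>.\<close>

lemma lindley_exponential_moment:
  fixes A Q :: "nat pmf"
  assumes Q: "Q = map_pmf (\<lambda>b. b - s) (map_pmf (\<lambda>(q, a). q + a) (pair_pmf Q A))"
    and r: "r > 1" and A: "summable (\<lambda>j. pmf A j * r ^ j)" and drift: "pgf A r < r ^ s"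
  shows "summable (\<lambda>j. pmf Q j * r ^ j)"
proof -
  define \<beta> where "\<beta> = pgf A r / r ^ s"
  have pgf_nn: "pgf A r \<ge> 0" unfolding pgf_def using A r by (intro suminf_nonneg) auto
  have \<beta>: "0 \<le> \<beta>" "\<beta> < 1" using drift r pgf_nn by (auto simp: \<beta>_def)
  define E :: "(nat \<Rightarrow> real) \<Rightarrow> real" where "E = measure_pmf.expectation Q"
  have intA: "integrable (measure_pmf A) (\<lambda>a. r ^ a)" "measure_pmf.expectation A (\<lambda>a. r ^ a) = pgf A r"
    using expectation_nat_pmf_sums[of A "\<lambda>a. r ^ a"] A r
    by (simp_all add: pgf_def sums_iff)
  have bd: "integrable (measure_pmf Q) f" if "\<And>q. 0 \<le> f q \<and> f q \<le> M" for f :: "nat \<Rightarrow> real" and M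
    by (rule measure_pmf.integrable_const_bound[where B = M]) (use that in \<open>auto intro: AE_pmfI\<close>)
  have main: "E (\<lambda>q. min (r ^ q) M) \<le> E (\<lambda>q. min (\<beta> * r ^ q + 1) M)" if M: "M \<ge> 0" for M
  proof -
    have inner: "(\<integral>\<^sup>+a. ennreal (min (r ^ (q + a - s)) M) \<partial>measure_pmf A) \<le> ennreal (min (\<beta> * r ^ q + 1) M)" for q
    proof -
      have "(\<integral>\<^sup>+a. ennreal (min (r ^ (q + a - s)) M) \<partial>measure_pmf A) \<le> (\<integral>\<^sup>+a. ennreal M \<partial>measure_pmf A)"
        by (intro nn_integral_mono ennreal_leI) auto
      hence 1: "(\<integral>\<^sup>+a. ennreal (min (r ^ (q + a - s)) M) \<partial>measure_pmf A) \<le> ennreal M" by simp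
      have "(\<integral>\<^sup>+a. ennreal (min (r ^ (q + a - s)) M) \<partial>measure_pmf A)
              \<le> (\<integral>\<^sup>+a. ennreal (r ^ q / r ^ s * r ^ a + 1) \<partial>measure_pmf A)"
      proof (intro nn_integral_mono ennreal_leI)
        fix a
        have "r ^ (q + a - s) \<le> r ^ q / r ^ s * r ^ a + 1"
        proof (cases "s \<le> q + a")
          case True
          hence "r ^ (q + a - s) = r ^ q * r ^ a / r ^ s" using r by (simp add: power_diff power_add)
          thus ?thesis by simp
        next
          case False
          thus ?thesis using r by simp
        qed
        thus "min (r ^ (q + a - s)) M \<le> r ^ q / r ^ s * r ^ a + 1" by linarith
      qed
      also have "\<dots> = ennreal (measure_pmf.expectation A (\<lambda>a. r ^ q / r ^ s * r ^ a + 1))"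
        using intA r by (intro nn_integral_eq_integral) auto
      also have "measure_pmf.expectation A (\<lambda>a. r ^ q / r ^ s * r ^ a + 1) = \<beta> * r ^ q + 1"
        using intA by (subst Bochner_Integration.integral_add) (auto simp: \<beta>_def)
      finally have 2: "(\<integral>\<^sup>+a. ennreal (min (r ^ (q + a - s)) M) \<partial>measure_pmf A) \<le> ennreal (\<beta> * r ^ q + 1)" .
      from 1 2 show ?thesis by (auto simp: min_def)
    qed
    have "(\<integral>\<^sup>+q. ennreal (min (r ^ q) M) \<partial>measure_pmf Q) =
            (\<integral>\<^sup>+q. \<integral>\<^sup>+a. ennreal (min (r ^ (q + a - s)) M) \<partial>measure_pmf A \<partial>measure_pmf Q)"
      by (subst Q) (simp add: nn_integral_pair_pmf')
    also have "\<dots> \<le> (\<integral>\<^sup>+q. ennreal (min (\<beta> * r ^ q + 1) M) \<partial>measure_pmf Q)"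
      by (intro nn_integral_mono inner)
    finally have "ennreal (E (\<lambda>q. min (r ^ q) M)) \<le> ennreal (E (\<lambda>q. min (\<beta> * r ^ q + 1) M))"
      unfolding E_def using r \<beta> M
      by (subst (asm) (1 2) nn_integral_eq_integral) (auto intro!: bd[of _ M])
    thus ?thesis
      unfolding E_def using r \<beta> M by (subst (asm) ennreal_le_iff) (auto intro!: integral_nonneg_AE AE_pmfI)
  qed
  have bound: "(\<Sum>j\<le>N. pmf Q j * r ^ j) \<le> 1 / (1 - \<beta>)" for N
  proof -
    \<comment> \<open>At this level \<open>f q \<le> M\<close> means \<open>q \<le> N\<close>.\<close>
    define M where "M = r ^ N"
    have M: "M \<ge> 0" using r by (simp add: M_def)
    define ind where "ind = (\<lambda>q. (if q \<le> N then 1 else 0) :: real)"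
    have "(1 - \<beta>) * (ind q * r ^ q) - 1 \<le> min (r ^ q) M - min (\<beta> * r ^ q + 1) M" for q
    proof (cases "q \<le> N")
      case True
      hence "r ^ q \<le> M" using r by (simp add: M_def power_increasing)
      thus ?thesis using True by (simp add: ind_def algebra_simps)
    next
      case False
      hence "r ^ q \<ge> M" using r by (simp add: M_def power_increasing)
      thus ?thesis using False by (simp add: ind_def)
    qed
    hence "E (\<lambda>q. (1 - \<beta>) * (ind q * r ^ q) - 1) \<le> E (\<lambda>q. min (r ^ q) M - min (\<beta> * r ^ q + 1) M)"
      unfolding E_def
      apply (intro integral_mono)
      subgoal using r by (intro Bochner_Integration.integrable_diff integrable_mult_right bd[of _ M]) (auto simp: ind_def M_def power_increasing)
      subgoal using r \<beta> M by (intro Bochner_Integration.integrable_diff bd[of _ M]) auto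
      by auto
    also have "\<dots> = E (\<lambda>q. min (r ^ q) M) - E (\<lambda>q. min (\<beta> * r ^ q + 1) M)"
      unfolding E_def using r \<beta> M by (intro Bochner_Integration.integral_diff bd[of _ M]) auto
    also have "\<dots> \<le> 0" using main[OF M] by simp
    also have "E (\<lambda>q. (1 - \<beta>) * (ind q * r ^ q) - 1) = (1 - \<beta>) * E (\<lambda>q. ind q * r ^ q) - 1"
      unfolding E_def using r
      apply (subst Bochner_Integration.integral_diff)
      subgoal by (intro integrable_mult_right bd[of _ M]) (auto simp: ind_def M_def power_increasing)
      by auto
    finally have "E (\<lambda>q. ind q * r ^ q) \<le> 1 / (1 - \<beta>)" using \<beta> by (simp add: field_simps)
    moreover have "E (\<lambda>q. ind q * r ^ q) = (\<Sum>j\<le>N. pmf Q j * r ^ j)"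
      unfolding E_def by (subst integral_measure_pmf[of "{..N}"]) (auto simp: ind_def split: if_splits)
    ultimately show ?thesis by simp
  qed
  have "(\<Sum>j<N. pmf Q j * r ^ j) \<le> 1 / (1 - \<beta>)" for N
    by (rule order.trans[OF sum_mono2 bound[of N]]) (use r in auto)
  thus ?thesis
    using r by (intro summableI_nonneg_bounded[where x = "1 / (1 - \<beta>)"]) auto
qed

section \<open>Wiener-Hopf factorization and the variance as a contour integral\<close>

lemma holomorphic_suminf:
  fixes f :: "nat \<Rightarrow> complex \<Rightarrow> complex"
  assumes "open S" "\<And>n. f n holomorphic_on S" "\<And>n z. z \<in> S \<Longrightarrow> norm (f n z) \<le> M n" "summable M"
  shows "(\<lambda>z. \<Sum>n. f n z) holomorphic_on S"
proof (rule holomorphic_uniform_sequence[OF assms(1)])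
  show "(\<lambda>z. \<Sum>i<n. f i z) holomorphic_on S" for n
    by (intro holomorphic_intros assms)
  have ul: "uniform_limit S (\<lambda>n z. \<Sum>i<n. f i z) (\<lambda>z. \<Sum>n. f n z) sequentially"
    by (rule Weierstrass_m_test[OF assms(3,4)])
  fix x assume "x \<in> S"
  with assms(1) obtain d where "d > 0" "cball x d \<subseteq> S" using open_contains_cball by blast
  with ul show "\<exists>d>0. cball x d \<subseteq> S \<and> uniform_limit (cball x d) (\<lambda>n z. \<Sum>i<n. f i z) (\<lambda>z. \<Sum>n. f n z) sequentially"
    using uniform_limit_on_subset by blast
qed

lemma has_integral_shift_period:
  fixes f :: "real \<Rightarrow> complex"
  assumes f: "(f has_integral I) {0..2 * pi}" and per: "\<And>x. f (x - 2 * pi) = f x"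
  shows "(f has_integral I) {- pi..pi}"
proof -
  have i: "f integrable_on {0..2 * pi}" using f by blast
  have "f integrable_on {0..pi}" "f integrable_on {pi..2 * pi}"
    by (rule integrable_subinterval_real[OF i]; simp)+
  then obtain J K where J: "(f has_integral J) {0..pi}" and K: "(f has_integral K) {pi..2 * pi}"
    by blast
  have "(f has_integral J + K) {0..2 * pi}" by (rule has_integral_combine[OF _ _ J K]) auto
  hence I: "I = J + K" using f by (rule has_integral_unique[rotated])
  have "((\<lambda>x. f (1 *\<^sub>R x + 2 * pi)) has_integral (1 / (\<bar>1\<bar> ^ DIM(real))) *\<^sub>R K) ((\<lambda>x. (1/1) *\<^sub>R x + -((1/1) *\<^sub>R (2 * pi))) ` cbox pi (2 * pi))"
    by (rule has_integral_affinity) (use K in auto)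
  moreover have "((\<lambda>x. x - 2 * pi) ` {pi..2 * pi}) = {- pi..0}"
    using image_add_atLeastAtMost'[of "- (2 * pi)" pi "2 * pi"] by simp
  moreover have "f (x + 2 * pi) = f x" for x using per[of "x + 2 * pi"] by simp
  ultimately have "(f has_integral K) {- pi..0}" by simp
  from has_integral_combine[OF _ _ this J] show ?thesis by (simp add: I add.commute)
qed

text \<open>The circle is parametrized by angles in \<open>[-\<pi>, \<pi>]\<close>, which puts the point of the circle nearest to the pole at 1 in the
interior of the parameter interval.\<close>

lemma has_integral_circle:
  assumes "(f has_contour_integral I) (circlepath 0 r)"
  shows "((\<lambda>u. f (of_real r * cis u) * (of_real r * cis u)) has_integral (I / \<i>)) {- pi..pi}"
proof -
  have "((\<lambda>u. f (0 + of_real r * cis u) * of_real r * \<i> * cis u) has_integral I) {0..2 * pi}"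
    using assms unfolding circlepath_def
    by (subst (asm) has_contour_integral_part_circlepath_iff) auto
  from has_integral_divide[OF this, of \<i>]
  have "((\<lambda>u. f (of_real r * cis u) * (of_real r * cis u)) has_integral (I / \<i>)) {0..2 * pi}"
    by (simp add: field_simps)
  thus ?thesis
    by (rule has_integral_shift_period) (simp add: cis_divide[symmetric])
qed

text \<open>The drift condition on the whole range of radii makes \<open>A(z) / z^s\<close> smaller than 1 in modulus throughout a closed
annulus outside the unit circle.\<close>

locale lindley_annulus =
  fixes A :: "nat pmf" and s :: nat and r0 r1 :: real
  assumes r0: "1 < r0" and r01: "r0 < r1"
    and summable_A: "summable (\<lambda>j. pmf A j * r1 ^ j)"
    and drift: "\<And>r. r0 \<le> r \<Longrightarrow> r \<le> r1 \<Longrightarrow> pgf A r < r ^ s"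
begin

text \<open>The value \<open>G z\<close> is the generating function \<open>E z^(A - s)\<close> of the net input in one period.\<close>

definition G :: "complex \<Rightarrow> complex" where "G z = pgf A z / z ^ s"

text \<open>The functions \<open>up l\<close> and \<open>down l\<close> split the Laurent series \<open>G z ^ l = E z^S\<close>, where \<open>S\<close> is the net input over \<open>l\<close>
periods, according to the sign of \<open>S\<close>. The part with \<open>S < 0\<close> is a polynomial in \<open>1 / z\<close> and is written as a function
of \<open>x = 1 / z\<close>.\<close>

definition up :: "nat \<Rightarrow> complex \<Rightarrow> complex" where
  "up l z = (\<Sum>m. of_real (pmf (demand A l) (m + l * s)) * z ^ m)"

definition down :: "nat \<Rightarrow> complex \<Rightarrow> complex" where
  "down l x = (\<Sum>k<l * s. of_real (pmf (demand A l) k) * x ^ (l * s - k))"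

text \<open>The nonnegative and the negative part of the logarithmic series \<open>\<Sum>\<^sub>l G z ^ l / l\<close>.\<close>

definition h_up :: "complex \<Rightarrow> complex" where
  "h_up z = (\<Sum>l. up (Suc l) z / of_nat (Suc l))"

definition h_down :: "complex \<Rightarrow> complex" where
  "h_down x = (\<Sum>l. down (Suc l) x / of_nat (Suc l))"

lemma r_pos: "0 < r0" "0 < r1" "1 < r1" using r0 r01 by auto

lemma summable_A': "r \<ge> 0 \<Longrightarrow> r \<le> r1 \<Longrightarrow> summable (\<lambda>j. pmf A j * r ^ j)"
  using pgf_summable(2)[OF summable_A, of r] by (simp add: sums_iff)

lemma ratio: assumes "r0 \<le> r" "r \<le> r1" shows "0 \<le> pgf A r / r ^ s" "pgf A r / r ^ s < 1"
proof -
  have "pgf A r \<ge> 0" unfolding pgf_def using summable_A'[of r] assms r_pos by (intro suminf_nonneg) auto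
  thus "0 \<le> pgf A r / r ^ s" "pgf A r / r ^ s < 1" using drift[of r] assms r_pos by auto
qed

lemma norm_G:
  assumes "r0 \<le> norm z" "norm z \<le> r1"
  shows "norm (G z) < 1"
proof -
  have "norm (pgf A z) \<le> pgf A (norm z)"
    using assms r_pos by (intro pgf_summable(3) summable_A') auto
  hence "norm (G z) \<le> pgf A (norm z) / norm z ^ s"
    using assms r_pos by (auto simp: G_def norm_divide norm_power intro!: divide_right_mono)
  also have "\<dots> < 1" using assms by (rule ratio)
  finally show ?thesis .
qed

text \<open>All coefficients are probabilities, so each half is bounded by its value at the extreme radius, where it is part of
a series of nonnegative terms with sum \<open>(A(r) / r^s)^l\<close>. These geometric bounds make the series defining \<open>h_up\<close> and
\<open>h_down\<close> converge uniformly.\<close>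

lemma up_bound:
  "summable (\<lambda>m. of_real (pmf (demand A l) (m + l * s)) * complex_of_real r1 ^ m)"
  "norm z \<le> r1 \<Longrightarrow> norm (up l z) \<le> (pgf A r1 / r1 ^ s) ^ l"
proof -
  let ?D = "demand A l"
  have D: "summable (\<lambda>j. pmf ?D j * r1 ^ j)" "pgf ?D r1 = pgf A r1 ^ l"
    using pgf_demand(1)[OF summable_A, of l] pgf_demand(2)[OF summable_A, of r1 l] r_pos by auto
  have eq: "pmf ?D (m + l * s) * r1 ^ m = (pmf ?D (m + l * s) * r1 ^ (m + l * s)) / r1 ^ (l * s)" for m
    using r_pos by (simp add: power_add)
  have S: "summable (\<lambda>m. pmf ?D (m + l * s) * r1 ^ m)"
    unfolding eq using D(1) by (intro summable_divide summable_ignore_initial_segment)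
  have "complex_of_real (pmf ?D (m + l * s)) * of_real r1 ^ m = of_real (pmf ?D (m + l * s) * r1 ^ m)" for m
    by simp
  thus "summable (\<lambda>m. of_real (pmf ?D (m + l * s)) * complex_of_real r1 ^ m)"
    using summable_of_real[OF S, where ?'a = complex] by simp
  have "(\<Sum>m. pmf ?D (m + l * s) * r1 ^ m) = (\<Sum>m. pmf ?D (m + l * s) * r1 ^ (m + l * s)) / r1 ^ (l * s)"
    unfolding eq using D(1) by (subst suminf_divide) (auto intro!: summable_ignore_initial_segment)
  also have "(\<Sum>m. pmf ?D (m + l * s) * r1 ^ (m + l * s)) \<le> pgf ?D r1"
    using suminf_split_initial_segment[OF D(1), of "l * s"] r_pos
    by (auto simp: pgf_def intro!: sum_nonneg)
  also have "pgf ?D r1 / r1 ^ (l * s) = (pgf A r1 / r1 ^ s) ^ l"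
    by (simp add: D power_divide power_mult[symmetric] mult.commute)
  finally have le: "(\<Sum>m. pmf ?D (m + l * s) * r1 ^ m) \<le> (pgf A r1 / r1 ^ s) ^ l"
    using r_pos by (simp add: divide_right_mono)
  assume z: "norm z \<le> r1"
  have tm: "norm (of_real (pmf ?D (m + l * s)) * z ^ m) \<le> pmf ?D (m + l * s) * r1 ^ m" for m
    using z by (auto simp: norm_mult norm_power intro!: mult_left_mono power_mono)
  have S': "summable (\<lambda>m. norm (of_real (pmf ?D (m + l * s)) * z ^ m))"
    by (rule summable_comparison_test[OF _ S]) (use tm in auto)
  have "norm (up l z) \<le> (\<Sum>m. norm (of_real (pmf ?D (m + l * s)) * z ^ m))"
    unfolding up_def by (rule summable_norm[OF S'])
  also have "\<dots> \<le> (\<Sum>m. pmf ?D (m + l * s) * r1 ^ m)" by (rule suminf_le[OF tm S' S])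
  finally show "norm (up l z) \<le> (pgf A r1 / r1 ^ s) ^ l" using le by linarith
qed

lemma down_bound:
  assumes "norm x \<le> 1 / r0"
  shows "norm (down l x) \<le> (pgf A r0 / r0 ^ s) ^ l"
proof -
  let ?D = "demand A l"
  have D: "summable (\<lambda>j. pmf ?D j * r0 ^ j)" "pgf ?D r0 = pgf A r0 ^ l"
    using pgf_demand(1)[OF summable_A'[of r0], of l] pgf_demand(2)[OF summable_A'[of r0], of r0 l] r_pos r01 by auto
  have "norm (down l x) \<le> (\<Sum>k<l * s. pmf ?D k * (1 / r0) ^ (l * s - k))"
    unfolding down_def using assms
    by (intro sum_norm_le) (auto simp: norm_mult norm_power intro!: mult_left_mono power_mono)
  also have "\<dots> = (\<Sum>k<l * s. pmf ?D k * r0 ^ k) / r0 ^ (l * s)"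
    unfolding sum_divide_distrib using r_pos by (intro sum.cong) (auto simp: power_diff power_divide)
  also have "\<dots> \<le> pgf ?D r0 / r0 ^ (l * s)"
    unfolding pgf_def using r_pos D(1) by (intro divide_right_mono) (auto intro!: sum_le_suminf)
  also have "\<dots> = (pgf A r0 / r0 ^ s) ^ l"
    by (simp add: D power_divide power_mult[symmetric] mult.commute)
  finally show ?thesis .
qed

lemma up_down:
  assumes "r0 \<le> norm z" "norm z \<le> r1"
  shows "up l z + down l (1 / z) = G z ^ l"
proof -
  let ?D = "demand A l"
  have z: "z \<noteq> 0" using assms r_pos by auto
  have D: "summable (\<lambda>j. pmf ?D j * r1 ^ j)" "pgf ?D z = pgf A z ^ l"
    using pgf_demand[OF summable_A] assms r_pos by auto
  have S: "summable (\<lambda>j. of_real (pmf ?D j) * z ^ j)"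
    using pgf_summable(2)[OF D(1)] assms by (auto simp: sums_iff)
  have "pgf ?D z = (\<Sum>m. of_real (pmf ?D (m + l * s)) * z ^ (m + l * s)) + (\<Sum>k<l * s. of_real (pmf ?D k) * z ^ k)"
    unfolding pgf_def by (rule suminf_split_initial_segment[OF S])
  also have "(\<Sum>m. of_real (pmf ?D (m + l * s)) * z ^ (m + l * s)) = z ^ (l * s) * up l z"
  proof -
    have "summable (\<lambda>m. of_real (pmf ?D (m + l * s)) * z ^ m)"
      using summable_mult2[OF summable_ignore_initial_segment[OF S, of "l * s"], of "1 / z ^ (l * s)"] z
      by (simp add: power_add)
    from suminf_mult[OF this, of "z ^ (l * s)"] show ?thesis
      by (simp add: up_def power_add mult_ac)
  qed
  also have "(\<Sum>k<l * s. of_real (pmf ?D k) * z ^ k) = z ^ (l * s) * down l (1 / z)"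
    unfolding down_def sum_distrib_left using z by (intro sum.cong) (auto simp: power_diff power_divide)
  finally have "pgf A z ^ l = z ^ (l * s) * (up l z + down l (1 / z))" by (simp add: D algebra_simps)
  thus ?thesis using z by (simp add: G_def power_divide power_mult[symmetric] mult.commute field_simps)
qed

lemma summable_geometric_ratio:
  "r0 \<le> r \<Longrightarrow> r \<le> r1 \<Longrightarrow> summable (\<lambda>l. (pgf A r / r ^ s) ^ Suc l)"
proof -
  assume "r0 \<le> r" "r \<le> r1"
  hence "norm (pgf A r / r ^ s) < 1" using ratio[of r] by (simp only: real_norm_def abs_of_nonneg)
  from summable_geometric[OF this] show ?thesis by (subst summable_Suc_iff)
qed

lemma div_Suc_le: "norm (w / of_nat (Suc l) :: complex) \<le> norm w"
  by (simp add: norm_divide del: of_nat_Suc) (simp add: divide_le_eq mult_le_cancel_left1)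

lemma h_term_bound:
  shows "norm z \<le> r1 \<Longrightarrow> norm (up (Suc l) z / of_nat (Suc l)) \<le> (pgf A r1 / r1 ^ s) ^ Suc l"
    and "norm z \<le> 1 / r0 \<Longrightarrow> norm (down (Suc l) z / of_nat (Suc l)) \<le> (pgf A r0 / r0 ^ s) ^ Suc l"
  using up_bound(2) down_bound div_Suc_le order.trans by blast+

lemma h_sums:
  shows "norm z \<le> r1 \<Longrightarrow> (\<lambda>l. up (Suc l) z / of_nat (Suc l)) sums h_up z"
    and "norm z \<le> 1 / r0 \<Longrightarrow> (\<lambda>l. down (Suc l) z / of_nat (Suc l)) sums h_down z"
proof -
  assume "norm z \<le> r1"
  thus "(\<lambda>l. up (Suc l) z / of_nat (Suc l)) sums h_up z" unfolding h_up_def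
    using h_term_bound(1) r01
    by (intro summable_sums summable_comparison_test[OF _ summable_geometric_ratio[of r1]]) (blast | simp)+
next
  assume "norm z \<le> 1 / r0"
  thus "(\<lambda>l. down (Suc l) z / of_nat (Suc l)) sums h_down z" unfolding h_down_def
    using h_term_bound(2) r01
    by (intro summable_sums summable_comparison_test[OF _ summable_geometric_ratio[of r0]]) force+
qed

lemma h_up_holomorphic: "h_up holomorphic_on ball 0 r1"
proof -
  have "up l holomorphic_on ball 0 r1" for l
    using power_series_holomorphic[OF up_bound(1)] by (simp add: up_def[abs_def])
  thus ?thesis
    unfolding h_up_def[abs_def] using r01
    by (intro holomorphic_suminf[where M = "\<lambda>l. (pgf A r1 / r1 ^ s) ^ Suc l"] holomorphic_intros
          h_term_bound summable_geometric_ratio) (auto simp del: of_nat_Suc)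
qed

lemma h_down_holomorphic: "h_down holomorphic_on ball 0 (1 / r0)"
proof -
  have "down l holomorphic_on ball 0 (1 / r0)" for l
    unfolding down_def[abs_def] by (intro holomorphic_intros)
  thus ?thesis
    unfolding h_down_def[abs_def] using r01
    by (intro holomorphic_suminf[where M = "\<lambda>l. (pgf A r0 / r0 ^ s) ^ Suc l"] holomorphic_intros
          h_term_bound summable_geometric_ratio) (auto simp del: of_nat_Suc)
qed

lemma log_split:
  assumes "r0 \<le> norm z" "norm z \<le> r1"
  shows "h_up z + h_down (1 / z) = - Ln (1 - G z)"
proof -
  have "norm z > 0" using assms r_pos by linarith
  hence "norm (1 / z) \<le> 1 / r0" using assms r_pos by (simp add: norm_divide frac_le)
  from sums_add[OF h_sums(1)[OF assms(2)] h_sums(2)[OF this]]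
  have "(\<lambda>l. G z ^ Suc l / of_nat (Suc l)) sums (h_up z + h_down (1 / z))"
    by (simp only: add_divide_distrib[symmetric] up_down[OF assms])
  moreover have "(\<lambda>l. - (G z ^ l) / of_nat l) sums Ln (1 - G z)"
    using Ln_series'[of "- G z"] norm_G[OF assms] by simp
  hence "(\<lambda>l. - (G z ^ Suc l) / of_nat (Suc l)) sums Ln (1 - G z)"
    by (subst sums_Suc_iff) simp
  hence "(\<lambda>l. G z ^ Suc l / of_nat (Suc l)) sums - Ln (1 - G z)"
    by (drule_tac sums_minus) simp
  ultimately show ?thesis using sums_unique2 by blast
qed

text \<open>The classical functional equation of the discrete queue, with \<open>B\<close> the law of \<open>Q + A\<close>: subtracting \<open>s\<close> and truncating
moves the mass of each \<open>b < s\<close> from the power \<open>b - s\<close> to the power 0. Its right-hand side is a polynomial in \<open>1 / z\<close>.\<close>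

lemma stationary_pgf_eq:
  assumes Q: "Q = map_pmf (\<lambda>b. b - s) B" and B: "B = map_pmf (\<lambda>(q, a). q + a) (pair_pmf Q A)"
    and summable_Q: "summable (\<lambda>j. pmf Q j * r1 ^ j)" and z: "z \<noteq> 0" "norm z \<le> r1"
  shows "pgf Q z * (1 - G z) = (\<Sum>b<s. of_real (pmf B b) * (1 - (1 / z) ^ (s - b)))"
proof -
  have sB: "summable (\<lambda>j. pmf B j * r1 ^ j)" and pB: "pgf B z = pgf Q z * pgf A z"
    unfolding B using pgf_sum_pair[OF summable_Q summable_A] r_pos z by auto
  have pmfQ: "pmf Q 0 = (\<Sum>b\<le>s. pmf B b)" "pmf Q (Suc j) = pmf B (Suc j + s)" for j
  proof -
    have "pmf Q 0 = measure (measure_pmf B) ((\<lambda>b. b - s) -` {0})"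
      by (subst Q) (simp add: pmf_map)
    also have "(\<lambda>b. b - s) -` {0} = {..s}" by auto
    finally show "pmf Q 0 = (\<Sum>b\<le>s. pmf B b)" by (simp add: measure_measure_pmf_finite)
    have "pmf Q (Suc j) = measure (measure_pmf B) ((\<lambda>b. b - s) -` {Suc j})"
      by (subst Q) (simp add: pmf_map)
    also have "(\<lambda>b. b - s) -` {Suc j} = {Suc j + s}" by auto
    finally show "pmf Q (Suc j) = pmf B (Suc j + s)" by (simp add: measure_pmf_single)
  qed
  define T where "T = (\<Sum>m. of_real (pmf B (m + s)) * z ^ m)"
  have SB: "(\<lambda>j. of_real (pmf B j) * z ^ j) sums pgf B z"
    using pgf_summable(2)[OF sB z(2)] .
  have S2: "summable (\<lambda>m. of_real (pmf B (m + s)) * z ^ m)"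
    using summable_mult2[OF summable_ignore_initial_segment[OF sums_summable[OF SB], of s], of "1 / z ^ s"] z
    by (simp add: power_add)
  have "pgf B z = (\<Sum>m. of_real (pmf B (m + s)) * z ^ (m + s)) + (\<Sum>b<s. of_real (pmf B b) * z ^ b)"
    unfolding pgf_def by (rule suminf_split_initial_segment[OF sums_summable[OF SB]])
  also have "(\<Sum>m. of_real (pmf B (m + s)) * z ^ (m + s)) = z ^ s * T"
    using suminf_mult[OF S2, of "z ^ s"] by (simp add: T_def power_add mult_ac)
  finally have T: "T = pgf B z / z ^ s - (\<Sum>b<s. of_real (pmf B b) * z ^ b) / z ^ s"
    using z by (simp add: field_simps)
  have "(\<lambda>j. of_real (pmf Q j) * z ^ j) sums pgf Q z"
    using pgf_summable(2)[OF summable_Q z(2)] .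
  moreover have "(\<lambda>j. of_real (pmf Q j) * z ^ j) =
      (\<lambda>j. of_real (pmf B (j + s)) * z ^ j + (if j = 0 then of_real (\<Sum>b<s. pmf B b) else 0))"
  proof
    fix j show "of_real (pmf Q j) * z ^ j =
      of_real (pmf B (j + s)) * z ^ j + (if j = 0 then of_real (\<Sum>b<s. pmf B b) else 0)"
      by (cases j) (simp_all add: pmfQ lessThan_Suc_atMost[symmetric])
  qed
  moreover have "(\<lambda>j. of_real (pmf B (j + s)) * z ^ j + (if j = 0 then of_real (\<Sum>b<s. pmf B b) else 0))
                   sums (T + of_real (\<Sum>b<s. pmf B b))"
    unfolding T_def
    by (intro sums_add summable_sums S2 sums_single[of 0 "\<lambda>_. of_real (\<Sum>b<s. pmf B b)"])
  ultimately have "pgf Q z = T + of_real (\<Sum>b<s. pmf B b)" using sums_unique2 by auto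
  hence "pgf Q z = pgf Q z * G z - (\<Sum>b<s. of_real (pmf B b) * z ^ b) / z ^ s + of_real (\<Sum>b<s. pmf B b)"
    by (simp add: T pB G_def)
  hence "pgf Q z * (1 - G z) = (\<Sum>b<s. of_real (pmf B b)) - (\<Sum>b<s. of_real (pmf B b) * z ^ b) / z ^ s"
    by (simp add: algebra_simps)
  also have "\<dots> = (\<Sum>b<s. of_real (pmf B b) * (1 - (1 / z) ^ (s - b)))"
    unfolding sum_divide_distrib sum_subtractf[symmetric] using z
    by (intro sum.cong) (auto simp: power_diff power_divide algebra_simps)
  finally show ?thesis .
qed

text \<open>Let \<open>W\<close> be the polynomial of the functional equation times \<open>exp (h_down x)\<close>, as a function of \<open>x = 1 / z\<close>. Because
\<open>1 - G z = exp (- h_up z - h_down (1 / z))\<close>, that equation reads \<open>Q(z) exp (- h_up z) = W (1 / z)\<close> on the annulus. The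
left side is holomorphic in \<open>|z| < r1\<close>, the right side is holomorphic in \<open>|z| > r0\<close> and bounded near infinity, and
Liouville's theorem applies to the entire function that they define together.\<close>

lemma wiener_hopf_factorization:
  assumes Q: "Q = map_pmf (\<lambda>b. b - s) (map_pmf (\<lambda>(q, a). q + a) (pair_pmf Q A))"
  shows "summable (\<lambda>j. pmf Q j * r1 ^ j)"
    and "\<exists>c. \<forall>z\<in>ball 0 r1. pgf Q z = c * exp (h_up z)"
proof -
  show summable_Q: "summable (\<lambda>j. pmf Q j * r1 ^ j)"
    by (rule lindley_exponential_moment[OF Q _ summable_A drift]) (use r_pos r01 in auto)
  define B where "B = map_pmf (\<lambda>(q, a). q + a) (pair_pmf Q A)"
  define W where "W = (\<lambda>x. (\<Sum>b<s. of_real (pmf B b) * (1 - x ^ (s - b))) * exp (h_down x))"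
  \<comment> \<open>The two branches agree on the annulus, so \<open>F\<close> is entire.\<close>
  define F where "F = (\<lambda>z. if norm z < r1 then pgf Q z * exp (- h_up z) else W (1 / z))"
  have F_out: "F z = W (1 / z)" if "norm z > r0" for z
  proof (cases "norm z < r1")
    case True
    have z: "z \<noteq> 0" using that r_pos by auto
    have "norm (G z) < 1" using that True by (intro norm_G) auto
    hence G: "1 - G z \<noteq> 0" by auto
    have "h_up z + h_down (1 / z) = - Ln (1 - G z)" using that True by (intro log_split) auto
    hence "h_down (1 / z) = - h_up z - Ln (1 - G z)"
      by (metis add_diff_cancel_left' minus_diff_commute)
    hence "exp (h_down (1 / z)) = exp (- h_up z - Ln (1 - G z))" by simp
    also have "\<dots> = exp (- h_up z) / (1 - G z)" using G by (simp add: exp_diff)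
    finally have hd: "exp (h_down (1 / z)) = exp (- h_up z) / (1 - G z)" .
    have "W (1 / z) = (pgf Q z * (1 - G z)) * (exp (- h_up z) / (1 - G z))"
      unfolding W_def hd using stationary_pgf_eq[OF Q[folded B_def] B_def summable_Q z] True by simp
    also have "\<dots> = pgf Q z * exp (- h_up z)" using G by simp
    finally have "W (1 / z) = pgf Q z * exp (- h_up z)" .
    thus ?thesis using True by (simp add: F_def)
  qed (simp add: F_def)
  have W_hol: "W holomorphic_on ball 0 (1 / r0)"
    unfolding W_def by (intro holomorphic_intros h_down_holomorphic)
  have F_hol_in: "F holomorphic_on ball 0 r1"
  proof -
    have "(\<lambda>z. pgf Q z * exp (- h_up z)) holomorphic_on ball 0 r1"
      by (intro holomorphic_intros h_up_holomorphic pgf_holomorphic summable_Q)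
    thus ?thesis by (rule holomorphic_transform) (auto simp: F_def)
  qed
  have in_ball: "1 / z \<in> ball 0 (1 / r0)" if "norm z > r0" for z :: complex
  proof -
    have "1 / norm z < 1 / r0" using that r_pos by (intro frac_less2) auto
    thus ?thesis by (simp add: norm_divide)
  qed
  have F_hol_out: "F holomorphic_on {z. norm z > r0}"
  proof -
    have "(\<lambda>z. W (1 / z)) holomorphic_on {z. norm z > r0}"
      using holomorphic_on_compose_gen[OF _ W_hol, of "\<lambda>z. 1 / z" "{z. norm z > r0}"] in_ball r_pos
      by (force simp: o_def intro!: holomorphic_intros)
    thus ?thesis by (rule holomorphic_transform) (auto simp: F_out)
  qed
  have open_out: "open {z :: complex. norm z > r0}"
    by (intro open_Collect_less continuous_intros)
  have "F holomorphic_on (ball 0 r1 \<union> {z. norm z > r0})"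
    by (intro holomorphic_on_Un F_hol_in F_hol_out open_out open_ball)
  also have "ball 0 r1 \<union> {z :: complex. norm z > r0} = UNIV" using r01 by auto
  finally have F_hol: "F holomorphic_on UNIV" .
  define \<rho> where "\<rho> = (r0 + r1) / 2"
  have \<rho>: "r0 < \<rho>" "\<rho> < r1" "\<rho> > 0" using r01 r_pos by (auto simp: \<rho>_def)
  have "compact (F ` cball 0 \<rho>)"
    by (intro compact_continuous_image holomorphic_on_imp_continuous_on holomorphic_on_subset[OF F_hol]) auto
  moreover have "compact (W ` cball 0 (1 / \<rho>))"
    using \<rho> r_pos
    by (intro compact_continuous_image holomorphic_on_imp_continuous_on holomorphic_on_subset[OF W_hol])
       (auto simp: cball_subset_ball_iff frac_less2)
  ultimately have "bounded (F ` cball 0 \<rho> \<union> W ` cball 0 (1 / \<rho>))"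
    by (simp add: compact_imp_bounded)
  moreover have "range F \<subseteq> F ` cball 0 \<rho> \<union> W ` cball 0 (1 / \<rho>)"
  proof
    fix y assume "y \<in> range F"
    then obtain z where y: "y = F z" by auto
    show "y \<in> F ` cball 0 \<rho> \<union> W ` cball 0 (1 / \<rho>)"
    proof (cases "norm z \<le> \<rho>")
      case False
      hence "norm (1 / z) \<le> 1 / \<rho>" using \<rho> by (simp add: norm_divide frac_le)
      hence "W (1 / z) \<in> W ` cball 0 (1 / \<rho>)" by (intro imageI) simp
      thus ?thesis using False \<rho> by (simp add: y F_out)
    qed (auto simp: y)
  qed
  ultimately have "bounded (range F)" by (rule bounded_subset)
  with F_hol have "F constant_on UNIV" by (rule Liouville_theorem)
  then obtain c where c: "F z = c" for z unfolding constant_on_def by auto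
  have "pgf Q z = c * exp (h_up z)" if "z \<in> ball 0 r1" for z
    using c[of z] that by (auto simp: F_def exp_minus field_simps)
  thus "\<exists>c. \<forall>z\<in>ball 0 r1. pgf Q z = c * exp (h_up z)" by blast
qed

text \<open>The logarithm of \<open>Q(z)\<close> is \<open>h_up z\<close> up to a constant, and the variance of a law is \<open>h'' + h'\<close> at 1 if \<open>h\<close> is
the logarithm of its generating function.\<close>

lemma variance_h_up:
  assumes Q: "Q = map_pmf (\<lambda>b. b - s) (map_pmf (\<lambda>(q, a). q + a) (pair_pmf Q A))"
  shows "of_real (var Q) = deriv (deriv h_up) 1 + deriv h_up 1"
proof -
  note summable_Q = wiener_hopf_factorization(1)[OF Q]
  obtain c where c: "\<And>z. z \<in> ball 0 r1 \<Longrightarrow> pgf Q z = c * exp (h_up z)"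
    using wiener_hopf_factorization(2)[OF Q] by blast
  have h': "(h_up has_field_derivative deriv h_up z) (at z)" if "z \<in> ball 0 r1" for z
    using h_up_holomorphic that by (intro holomorphic_derivI[OF _ open_ball])
  have h'': "(deriv h_up has_field_derivative deriv (deriv h_up) z) (at z)" if "z \<in> ball 0 r1" for z
    using h_up_holomorphic that by (intro holomorphic_derivI[OF _ open_ball] holomorphic_deriv) auto
  have ev: "eventually (\<lambda>z. z \<in> ball 0 r1) (nhds z)" if "z \<in> ball 0 r1" for z :: complex
    using that by (intro eventually_nhds_in_open) auto
  have one: "(1::complex) \<in> ball 0 r1" using r_pos by simp
  have d1: "deriv (pgf Q) z = pgf Q z * deriv h_up z" if "z \<in> ball 0 r1" for z
  proof -
    have "deriv (pgf Q) z = deriv (\<lambda>z. c * exp (h_up z)) z"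
      by (intro deriv_cong_ev refl eventually_mono[OF ev[OF that]] c)
    also have "\<dots> = c * (exp (h_up z) * deriv h_up z)"
      by (intro DERIV_imp_deriv DERIV_cmult DERIV_fun_exp h' that)
    finally show ?thesis using c[OF that] by simp
  qed
  have "deriv (deriv (pgf Q)) 1 = deriv (\<lambda>z. pgf Q z * deriv h_up z) 1"
    by (intro deriv_cong_ev refl eventually_mono[OF ev[OF one]] d1)
  also have "\<dots> = deriv (pgf Q) 1 * deriv h_up 1 + deriv (deriv h_up) 1 * pgf Q 1"
    by (intro DERIV_imp_deriv DERIV_mult h'' one holomorphic_derivI[OF pgf_holomorphic[OF summable_Q] open_ball])
  finally have "deriv (deriv (pgf Q)) 1 = (deriv h_up 1)\<^sup>2 + deriv (deriv h_up) 1"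
    by (simp add: d1[OF one] power2_eq_square)
  moreover have "deriv (pgf Q) 1 = deriv h_up 1" by (simp add: d1[OF one])
  ultimately show ?thesis
    using pgf_moments[OF summable_Q r_pos(3)] by (simp add: algebra_simps)
qed

lemma contour_integrand_continuous:
  assumes r: "r0 < r" "r < r1"
  shows "continuous_on S (\<lambda>u. let z = of_real r * cis u in - Ln (1 - G z) * (z * (z + 1) / (z - 1) ^ 3))"
proof -
  have rp: "r > 1" using r r0 by auto
  define z where "z = (\<lambda>u. of_real r * cis u)"
  have nz: "norm (z u) = r" for u using rp by (simp add: z_def norm_mult)
  have ne: "z u \<noteq> 0" "z u \<noteq> 1" for u using nz[of u] rp by auto
  have cz: "continuous_on S z" unfolding z_def by (intro continuous_intros)
  have "continuous_on (ball 0 r1) (pgf A :: complex \<Rightarrow> complex)"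
    by (intro holomorphic_on_imp_continuous_on pgf_holomorphic summable_A)
  hence cA: "continuous_on S (\<lambda>u. pgf A (z u))"
    by (rule continuous_on_compose2[OF _ cz]) (use nz r in auto)
  have "1 - G (z u) \<notin> \<real>\<^sub>\<le>\<^sub>0" for u
  proof
    assume "1 - G (z u) \<in> \<real>\<^sub>\<le>\<^sub>0"
    hence "Re (1 - G (z u)) \<le> 0" by (simp add: complex_nonpos_Reals_iff)
    moreover have "norm (G (z u)) < 1" using nz r by (intro norm_G) auto
    ultimately show False using complex_Re_le_cmod[of "G (z u)"] by simp
  qed
  moreover have "continuous_on S (\<lambda>u. G (z u))"
    unfolding G_def using ne by (intro continuous_intros cA cz) auto
  ultimately have "continuous_on S (\<lambda>u. - Ln (1 - G (z u)) * (z u * (z u + 1) / (z u - 1) ^ 3))"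
    using ne by (intro continuous_intros cz) auto
  thus ?thesis by (simp add: Let_def z_def)
qed

text \<open>Since \<open>(z + 1) / (z - 1)^3 = 1 / (z - 1)^2 + 2 / (z - 1)^3\<close>, Cauchy's formula for derivatives turns the contribution
of \<open>h_up\<close> into \<open>h_up' + h_up''\<close> at 1. In the variable \<open>x = 1 / z\<close> the kernel is \<open>x (1 + x) / (1 - x)^3\<close>, which
vanishes at 0; so by the mean value property the contribution of \<open>h_down\<close> is 0. This converts the variance into an
integral of \<open>- Ln (1 - G z)\<close> alone.\<close>

lemma variance_contour_integral:
  assumes Q: "Q = map_pmf (\<lambda>b. b - s) (map_pmf (\<lambda>(q, a). q + a) (pair_pmf Q A))"
    and r: "r0 < r" "r < r1"
  shows "((\<lambda>u. let z = of_real r * cis u in - Ln (1 - G z) * (z * (z + 1) / (z - 1) ^ 3))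
           has_integral (of_real (2 * pi * var Q))) {- pi..pi}"
proof -
  have r1': "r > 1" "r > 0" using r r0 by auto
  have cont: "continuous_on (cball 0 r) h_up" and hol: "h_up holomorphic_on ball 0 r"
    using h_up_holomorphic r
    by (auto intro!: holomorphic_on_imp_continuous_on holomorphic_on_subset[OF h_up_holomorphic])
  have one: "(1 :: complex) \<in> ball 0 r" using r1' by simp
  have c1: "((\<lambda>z. h_up z / (z - 1)\<^sup>2) has_contour_integral (2 * pi * \<i> * deriv h_up 1)) (circlepath 0 r)"
    using Cauchy_has_contour_integral_higher_derivative_circlepath[OF cont hol one, of 1]
    by (simp add: numeral_2_eq_2)
  have c2: "((\<lambda>z. h_up z / (z - 1) ^ 3) has_contour_integral (pi * \<i> * deriv (deriv h_up) 1)) (circlepath 0 r)"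
    using Cauchy_has_contour_integral_higher_derivative_circlepath[OF cont hol one, of 2]
    by (simp add: numeral_2_eq_2 numeral_3_eq_3)
  have "((\<lambda>z. h_up z / (z - 1)\<^sup>2 + 2 * (h_up z / (z - 1) ^ 3)) has_contour_integral
          (2 * pi * \<i> * deriv h_up 1 + 2 * (pi * \<i> * deriv (deriv h_up) 1))) (circlepath 0 r)"
    by (intro has_contour_integral_add has_contour_integral_lmul c1 c2)
  also have "2 * pi * \<i> * deriv h_up 1 + 2 * (pi * \<i> * deriv (deriv h_up) 1) = of_real (2 * pi * var Q) * \<i>"
    by (simp add: variance_h_up[OF Q] algebra_simps)
  finally have "((\<lambda>z. h_up z / (z - 1)\<^sup>2 + 2 * (h_up z / (z - 1) ^ 3)) has_contour_integral
          (of_real (2 * pi * var Q) * \<i>)) (circlepath 0 r)" .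
  from has_integral_circle[OF this] have I1: "((\<lambda>u. (h_up (of_real r * cis u) / (of_real r * cis u - 1)\<^sup>2 +
       2 * (h_up (of_real r * cis u) / (of_real r * cis u - 1) ^ 3)) * (of_real r * cis u))
       has_integral (of_real (2 * pi * var Q))) {- pi..pi}"
    by (simp only: nonzero_mult_div_cancel_right complex_i_not_zero not_False_eq_True)
  define g where "g = (\<lambda>x :: complex. h_down x * (x * (1 + x) / (1 - x) ^ 3))"
  have "1 / r < 1 / r0" using r r0 by (simp add: frac_less2)
  hence sub: "cball 0 (1 / r) \<subseteq> ball (0 :: complex) (1 / r0)"
    by (auto simp: cball_subset_ball_iff)
  have ne1: "x \<noteq> 1" if "x \<in> cball 0 (1 / r)" for x :: complex
    using that r1' by auto
  have g_hol: "g holomorphic_on cball 0 (1 / r)"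
    unfolding g_def using ne1
    by (intro holomorphic_intros holomorphic_on_subset[OF h_down_holomorphic sub]) auto
  have "((\<lambda>x. g x / (x - 0)) has_contour_integral (2 * of_real pi * \<i> * g 0)) (circlepath 0 (1 / r))"
    by (rule Cauchy_integral_circlepath)
       (use g_hol r1' in \<open>auto intro!: holomorphic_on_imp_continuous_on intro: holomorphic_on_subset\<close>)
  hence "((\<lambda>x. g x / x) has_contour_integral 0) (circlepath 0 (1 / r))" by (simp add: g_def)
  from has_integral_circle[OF this]
  have "((\<lambda>u. g (of_real (1 / r) * cis u)) has_integral 0) {- pi..pi}"
    using r1' by simp
  hence "((\<lambda>u. g (of_real (1 / r) * cis (- u))) has_integral 0) {- pi..- (- pi)}"
    by (subst has_integral_reflect_real) auto
  hence I2: "((\<lambda>u. g (1 / (of_real r * cis u))) has_integral 0) {- pi..pi}"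
    by (simp add: cis_inverse[symmetric] field_simps)
  have "((\<lambda>u. (h_up (of_real r * cis u) / (of_real r * cis u - 1)\<^sup>2 +
       2 * (h_up (of_real r * cis u) / (of_real r * cis u - 1) ^ 3)) * (of_real r * cis u) +
       g (1 / (of_real r * cis u)))
       has_integral (of_real (2 * pi * var Q) + 0)) {- pi..pi}"
    by (rule has_integral_add[OF I1 I2])
  moreover have "(h_up z / (z - 1)\<^sup>2 + 2 * (h_up z / (z - 1) ^ 3)) * z + g (1 / z) =
       - Ln (1 - G z) * (z * (z + 1) / (z - 1) ^ 3)" if "norm z = r" for z
  proof -
    have z: "z \<noteq> 0" "z \<noteq> 1" using that r1' by auto
    define c where "c = (z - 1) ^ 3"
    have c: "c \<noteq> 0" using z by (simp add: c_def)
    have "h_up z / (z - 1)\<^sup>2 = h_up z * (z - 1) / c"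
      using z by (simp add: c_def power2_eq_square power3_eq_cube)
    hence "(h_up z / (z - 1)\<^sup>2 + 2 * (h_up z / (z - 1) ^ 3)) * z = (h_up z * (z - 1) / c + 2 * (h_up z / c)) * z"
      by (simp only: c_def)
    also have "\<dots> = h_up z * (z * (z + 1) / c)" using c by (simp add: field_simps)
    finally have "(h_up z / (z - 1)\<^sup>2 + 2 * (h_up z / (z - 1) ^ 3)) * z = h_up z * (z * (z + 1) / (z - 1) ^ 3)"
      by (simp only: c_def)
    moreover have "(1 / z) * (1 + 1 / z) / (1 - 1 / z) ^ 3 = z * (z + 1) / (z - 1) ^ 3"
    proof -
      have "1 - 1 / z = (z - 1) / z" using z by (simp add: field_simps)
      hence "(1 - 1 / z) ^ 3 = c / z ^ 3" by (simp only: power_divide c_def)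
      hence "(1 / z) * (1 + 1 / z) / (1 - 1 / z) ^ 3 = (1 / z) * (1 + 1 / z) / (c / z ^ 3)" by simp
      also have "\<dots> = z * (z + 1) / c" using z c by (simp add: field_simps power3_eq_cube)
      finally show ?thesis by (simp only: c_def)
    qed
    ultimately have "(h_up z / (z - 1)\<^sup>2 + 2 * (h_up z / (z - 1) ^ 3)) * z + g (1 / z) =
       (h_up z + h_down (1 / z)) * (z * (z + 1) / (z - 1) ^ 3)"
      unfolding g_def by (simp only: distrib_right)
    thus ?thesis using log_split[of z] that r by simp
  qed
  hence "(h_up (of_real r * cis u) / (of_real r * cis u - 1)\<^sup>2 +
       2 * (h_up (of_real r * cis u) / (of_real r * cis u - 1) ^ 3)) * (of_real r * cis u) +
       g (1 / (of_real r * cis u)) =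
       - Ln (1 - G (of_real r * cis u)) * (of_real r * cis u * (of_real r * cis u + 1) / (of_real r * cis u - 1) ^ 3)"
    for u using r1' by (simp add: norm_mult)
  ultimately show ?thesis by (simp add: Let_def)
qed

end

section \<open>Local expansions of the integration kernel and of the cumulant generating function\<close>

lemma exp_minus_one_nonzero:
  assumes "norm (w :: complex) < 6" "w \<noteq> 0"
  shows "exp w \<noteq> 1"
proof
  assume "exp w = 1"
  then obtain n :: int where n: "Re w = 0" "Im w = of_int (2 * n) * pi" by (auto simp: exp_eq_1)
  have "n \<noteq> 0" using n assms(2) by (auto simp: complex_eq_iff)
  hence "\<bar>real_of_int n\<bar> \<ge> 1" by linarith
  hence "\<bar>Im w\<bar> \<ge> 2 * pi" using n(2) by (simp add: abs_mult)
  moreover have "\<bar>Im w\<bar> \<le> norm w" by (rule abs_Im_le_cmod)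
  ultimately show False using assms(1) pi_gt3 by linarith
qed

text \<open>The function \<open>1 / (e^w - 1) - 1 / w\<close> has a removable singularity at 0 and is holomorphic in \<open>|w| < 6\<close>, because
\<open>6 < 2 \<pi>\<close>. The difference of the two kernels is its second derivative. The radius 5 covers all \<open>\<theta> + \<i> u\<close> with
\<open>0 \<le> \<theta> \<le> 1\<close> and \<open>|u| \<le> \<pi>\<close>.\<close>

lemma kernel_near_pole:
  shows "\<exists>C. \<forall>w :: complex. norm w \<le> 5 \<longrightarrow> w \<noteq> 0 \<longrightarrow>
           norm (exp w * (exp w + 1) / (exp w - 1) ^ 3 - 2 / w ^ 3) \<le> (C :: real)"
proof -
  define g where "g = (\<lambda>w :: complex. if w = 0 then deriv exp 0 else (exp w - exp 0) / (w - 0))"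
  have g_hol: "g holomorphic_on ball 0 6"
    unfolding g_def by (rule pole_lemma) (auto intro: holomorphic_intros)
  have g_nz: "g w \<noteq> 0" if "w \<in> ball 0 6" for w
    using exp_minus_one_nonzero[of w] that by (auto simp: g_def DERIV_imp_deriv[OF DERIV_exp])
  have g0: "g 0 = 1" by (simp add: g_def DERIV_imp_deriv[OF DERIV_exp])
  define f where "f = (\<lambda>w. 1 / g w)"
  have f_hol: "f holomorphic_on ball 0 6"
    unfolding f_def using g_nz by (intro holomorphic_intros g_hol) auto
  define B where "B = (\<lambda>w. if w = 0 then deriv f 0 else (f w - f 0) / (w - 0))"
  have B_hol: "B holomorphic_on ball 0 6"
    unfolding B_def by (rule pole_lemma[OF f_hol]) auto
  have B: "B w = 1 / (exp w - 1) - 1 / w" if "w \<in> ball 0 6 - {0}" for w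
    using that g0 exp_minus_one_nonzero[of w] by (auto simp: B_def f_def g_def divide_simps)
  have op: "open (ball (0::complex) 6 - {0})" by auto
  have nz: "exp w - 1 \<noteq> 0" "w \<noteq> 0" if "w \<in> ball (0::complex) 6 - {0}" for w
    using that exp_minus_one_nonzero[of w] by auto
  have B1: "deriv B w = - exp w / (exp w - 1)\<^sup>2 + 1 / w\<^sup>2" if "w \<in> ball 0 6 - {0}" for w
  proof -
    have "deriv B w = deriv (\<lambda>w. 1 / (exp w - 1) - 1 / w) w"
      using eventually_nhds_in_open[OF op that] by (intro deriv_cong_ev refl) (auto elim!: eventually_mono intro: B)
    also have "\<dots> = - exp w / (exp w - 1)\<^sup>2 + 1 / w\<^sup>2"
      using nz[OF that] by (intro DERIV_imp_deriv) (auto intro!: derivative_eq_intros simp: power2_eq_square)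
    finally show ?thesis .
  qed
  have B2: "deriv (deriv B) w = exp w * (exp w + 1) / (exp w - 1) ^ 3 - 2 / w ^ 3" if "w \<in> ball 0 6 - {0}" for w
  proof -
    have "deriv (deriv B) w = deriv (\<lambda>w. - exp w / (exp w - 1)\<^sup>2 + 1 / w\<^sup>2) w"
      by (intro deriv_cong_ev refl eventually_mono[OF eventually_nhds_in_open[OF op that] B1])
    also have "\<dots> = (- exp w * (exp w - 1)\<^sup>2 - (- exp w) * (2 * (exp w - 1) * exp w)) / ((exp w - 1)\<^sup>2 * (exp w - 1)\<^sup>2)
                     + (0 * w\<^sup>2 - 1 * (2 * w)) / (w\<^sup>2 * w\<^sup>2)"
    proof (rule DERIV_imp_deriv, rule DERIV_add)
      have a: "((\<lambda>w. - exp w) has_field_derivative - exp w) (at w)"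
        by (auto intro!: derivative_eq_intros)
      have b: "((\<lambda>w. (exp w - 1)\<^sup>2) has_field_derivative 2 * (exp w - 1) * exp w) (at w)"
        by (auto intro!: derivative_eq_intros)
      have c: "((\<lambda>w. w\<^sup>2) has_field_derivative 2 * w) (at w)"
        by (auto intro!: derivative_eq_intros)
      show "((\<lambda>w. - exp w / (exp w - 1)\<^sup>2) has_field_derivative (- exp w * (exp w - 1)\<^sup>2 -
         (- exp w) * (2 * (exp w - 1) * exp w)) / ((exp w - 1)\<^sup>2 * (exp w - 1)\<^sup>2)) (at w)"
        by (rule DERIV_divide[OF a b]) (use nz[OF that] in simp)
      show "((\<lambda>w. 1 / w\<^sup>2) has_field_derivative (0 * w\<^sup>2 - 1 * (2 * w)) / (w\<^sup>2 * w\<^sup>2)) (at w)"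
        by (rule DERIV_divide[OF DERIV_const c]) (use nz[OF that] in simp)
    qed
    also have "\<dots> = exp w * (exp w + 1) / (exp w - 1) ^ 3 - 2 / w ^ 3"
    proof -
      define e where "e = exp w"
      have e1: "e - 1 \<noteq> 0" unfolding e_def using nz[OF that] by blast
      have "(- e * (e - 1)\<^sup>2 - (- e) * (2 * (e - 1) * e)) / ((e - 1)\<^sup>2 * (e - 1)\<^sup>2) = e * (e + 1) / (e - 1) ^ 3"
      proof -
        have "- e * d\<^sup>2 - (- e) * (2 * d * e) = d * (e * (2 * e - d))" for d
          by (simp add: power2_eq_square right_diff_distrib mult_ac)
        from this[of "e - 1"]
        have "- e * (e - 1)\<^sup>2 - (- e) * (2 * (e - 1) * e) = (e - 1) * (e * (e + 1))" by simp
        moreover have "(e - 1)\<^sup>2 * (e - 1)\<^sup>2 = (e - 1) * (e - 1) ^ 3" by (simp only: power2_eq_square power3_eq_cube mult.assoc)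
        ultimately show ?thesis
          by (simp only: nonzero_mult_divide_mult_cancel_left[OF e1])
      qed
      moreover have "(0 * w\<^sup>2 - 1 * (2 * w)) / (w\<^sup>2 * w\<^sup>2) = - (2 / w ^ 3)"
      proof -
        have "0 * w\<^sup>2 - 1 * (2 * w) = w * (- 2)" "w\<^sup>2 * w\<^sup>2 = w * w ^ 3"
          by (simp_all add: power2_eq_square power3_eq_cube)
        thus ?thesis using nonzero_mult_divide_mult_cancel_left[OF nz(2)[OF that], of "- 2" "w ^ 3"]
          by (simp only: minus_divide_left)
      qed
      ultimately show ?thesis by (simp only: e_def diff_conv_add_uminus[of _ "2 / w ^ 3"])
    qed
    finally show ?thesis .
  qed
  have B2_hol: "deriv (deriv B) holomorphic_on ball 0 6"
    by (intro holomorphic_deriv B_hol open_ball)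
  have "continuous_on (cball 0 5) (deriv (deriv B))"
    by (intro holomorphic_on_imp_continuous_on holomorphic_on_subset[OF B2_hol]) auto
  hence "compact (deriv (deriv B) ` cball 0 5)" by (intro compact_continuous_image) auto
  hence "bounded (deriv (deriv B) ` cball 0 5)" by (rule compact_imp_bounded)
  then obtain C where C: "\<And>w. w \<in> cball 0 5 \<Longrightarrow> norm (deriv (deriv B) w) \<le> C"
    unfolding bounded_iff by blast
  show ?thesis
  proof (intro exI[of _ C] allI impI)
    fix w :: complex assume w: "norm w \<le> 5" "w \<noteq> 0"
    hence "w \<in> ball 0 6 - {0}" "w \<in> cball 0 5" by auto
    thus "norm (exp w * (exp w + 1) / (exp w - 1) ^ 3 - 2 / w ^ 3) \<le> C"
      using C[of w] by (simp only: B2)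
  qed
qed

lemma holomorphic_Taylor2:
  assumes "f holomorphic_on ball 0 R" "0 < \<eta>" "\<eta> < R"
  shows "\<exists>C\<ge>0. \<forall>w. norm w \<le> \<eta> \<longrightarrow>
           norm (f w - (f 0 + deriv f 0 * w + deriv (deriv f) 0 * w\<^sup>2 / 2)) \<le> C * norm w ^ 3"
proof -
  define D where "D = (\<lambda>i :: nat. (deriv ^^ i) f)"
  have D_hol: "D i holomorphic_on ball 0 R" for i
    unfolding D_def by (intro holomorphic_higher_deriv assms open_ball)
  have "compact (D 3 ` cball 0 \<eta>)"
    using assms by (intro compact_continuous_image holomorphic_on_imp_continuous_on holomorphic_on_subset[OF D_hol]) auto
  hence "bounded (D 3 ` cball 0 \<eta>)" by (rule compact_imp_bounded)
  then obtain C where C: "\<And>w. w \<in> cball 0 \<eta> \<Longrightarrow> norm (D 3 w) \<le> C"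
    unfolding bounded_iff by blast
  have C0: "C \<ge> 0" using assms by (intro order.trans[OF norm_ge_zero C[of 0]]) auto
  have "norm (f w - (f 0 + deriv f 0 * w + deriv (deriv f) 0 * w\<^sup>2 / 2)) \<le> C * norm w ^ 3" if "norm w \<le> \<eta>" for w
  proof -
    have "norm (D 0 w - (\<Sum>i\<le>2. D i 0 * (w - 0) ^ i / fact i)) \<le> C * norm (w - 0) ^ Suc 2 / fact 2"
    proof (rule complex_Taylor[of "cball 0 \<eta>"])
      fix i x assume x: "x \<in> cball (0::complex) \<eta>"
      hence "x \<in> ball 0 R" using assms by auto
      hence "(D i has_field_derivative deriv (D i) x) (at x)"
        by (intro holomorphic_derivI[OF D_hol open_ball])
      thus "(D i has_field_derivative D (Suc i) x) (at x within cball 0 \<eta>)"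
        by (auto simp: D_def intro: has_field_derivative_at_within)
    qed (use C that assms in \<open>auto simp: numeral_3_eq_3 numeral_2_eq_2\<close>)
    also have "C * norm (w - 0) ^ Suc 2 / fact 2 \<le> C * norm w ^ 3"
      using C0 by (simp add: fact_2 numeral_3_eq_3 mult_nonneg_nonneg)
    finally show ?thesis by (simp add: D_def numeral_2_eq_2 algebra_simps)
  qed
  with C0 show ?thesis by blast
qed

text \<open>The function \<open>\<phi>\<close> is the cumulant generating function \<open>log E e^(w X)\<close>, whose first two derivatives at 0 are the mean and
the variance.\<close>

lemma cumulant_expansion:
  fixes X :: "nat pmf"
  assumes X: "summable (\<lambda>j. pmf X j * r ^ j)" "r > 1"
  shows "\<exists>(\<phi> :: complex \<Rightarrow> complex) \<eta> C. 0 < \<eta> \<and> 0 \<le> C \<and> exp \<eta> \<le> r \<and>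
          (\<forall>w. norm w \<le> \<eta> \<longrightarrow> pgf X (exp w) = exp (\<phi> w) \<and>
             norm (\<phi> w - (of_real (mean X) * w + of_real (var X) * w\<^sup>2 / 2)) \<le> C * norm w ^ 3)"
proof -
  define M where "M = (\<lambda>w. pgf X (exp w :: complex))"
  define R0 where "R0 = ln r"
  have R0: "R0 > 0" "exp R0 = r" using X(2) by (auto simp: R0_def)
  have exp_in: "exp w \<in> ball 0 r" if "w \<in> ball 0 R0" for w :: complex
  proof -
    have "Re w < R0" using that complex_Re_le_cmod[of w] by simp
    hence "exp (Re w) < exp R0" by simp
    thus ?thesis using R0 by simp
  qed
  have M_hol: "M holomorphic_on ball 0 R0"
  proof -
    have "exp ` ball 0 R0 \<subseteq> ball (0::complex) r" using exp_in by blast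
    from holomorphic_on_compose_gen[OF holomorphic_on_exp pgf_holomorphic[OF X(1)] this]
    show ?thesis by (simp add: M_def[abs_def] o_def)
  qed
  have M0: "M 0 = 1" by (simp add: M_def)
  have "isCont M 0" using M_hol R0 by (auto intro!: continuous_on_interior[OF holomorphic_on_imp_continuous_on])
  then obtain \<delta> where \<delta>: "\<delta> > 0" "\<And>w. norm w < \<delta> \<Longrightarrow> norm (M w - 1) < 1"
    unfolding continuous_at_eps_delta by (metis M0 dist_norm diff_zero zero_less_one)
  define R where "R = min \<delta> R0"
  have R: "R > 0" "R \<le> R0" using \<delta> R0 by (auto simp: R_def)
  have M_slit: "M w \<notin> \<real>\<^sub>\<le>\<^sub>0" if "w \<in> ball 0 R" for w
  proof
    assume "M w \<in> \<real>\<^sub>\<le>\<^sub>0"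
    hence "Re (M w) \<le> 0" by (auto elim!: nonpos_Reals_cases)
    moreover have "\<bar>Re (M w - 1)\<bar> \<le> norm (M w - 1)" by (rule abs_Re_le_cmod)
    moreover have "norm (M w - 1) < 1" using \<delta>(2)[of w] that by (auto simp: R_def)
    ultimately show False by auto
  qed
  define \<phi> where "\<phi> = (\<lambda>w. Ln (M w))"
  have M_hol': "M holomorphic_on ball 0 R" using M_hol R by (auto intro: holomorphic_on_subset)
  have \<phi>_hol: "\<phi> holomorphic_on ball 0 R"
    unfolding \<phi>_def using M_slit by (intro holomorphic_intros M_hol') auto
  have M_nz: "M w \<noteq> 0" if "w \<in> ball 0 R" for w using M_slit[OF that] by auto
  have exp_\<phi>: "pgf X (exp w) = exp (\<phi> w)" if "w \<in> ball 0 R" for w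
    using M_nz[OF that] by (simp add: \<phi>_def M_def)
  have ev: "eventually (\<lambda>w. w \<in> ball 0 R) (nhds w)" if "w \<in> ball 0 R" for w :: complex
    using that by (intro eventually_nhds_in_open) auto
  have zero: "0 \<in> ball (0::complex) R" using R by simp
  have P': "(pgf X has_field_derivative deriv (pgf X) z) (at z)"
           "(deriv (pgf X) has_field_derivative deriv (deriv (pgf X)) z) (at z)" if "z \<in> ball (0::complex) r" for z
    using that by (auto intro!: holomorphic_derivI[OF _ open_ball] holomorphic_deriv pgf_holomorphic X)
  have d1: "deriv \<phi> w = deriv (pgf X) (exp w) * exp w / M w" if "w \<in> ball 0 R" for w
  proof -
    have "exp w \<in> ball 0 r" using exp_in that R by auto
    hence "(M has_field_derivative deriv (pgf X) (exp w) * exp w) (at w)"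
      unfolding M_def by (intro DERIV_chain2[of "pgf X"] P' DERIV_exp)
    hence "(\<phi> has_field_derivative inverse (M w) * (deriv (pgf X) (exp w) * exp w)) (at w)"
      unfolding \<phi>_def by (rule DERIV_chain2[where f = Ln and g = M, OF has_field_derivative_Ln[OF M_slit[OF that]]])
    from DERIV_imp_deriv[OF this] show ?thesis by (simp add: divide_inverse mult.commute)
  qed
  have one: "(1::complex) \<in> ball 0 r" using X(2) by simp
  have d2: "deriv (deriv \<phi>) 0 = of_real (var X)"
  proof -
    have "deriv (deriv \<phi>) 0 = deriv (\<lambda>w. deriv (pgf X) (exp w) * exp w / pgf X (exp w)) 0"
      by (intro deriv_cong_ev refl eventually_mono[OF ev[OF zero]]) (auto simp: d1 M_def)
    also have "\<dots> = ((deriv (deriv (pgf X)) 1 * 1) * 1 + 1 * deriv (pgf X) 1) * 1 - deriv (pgf X) 1 * (deriv (pgf X) 1)"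
    proof (rule DERIV_imp_deriv)
      have e: "(exp has_field_derivative 1) (at (0::complex))" using DERIV_exp[of "0::complex"] by simp
      have a: "((\<lambda>w. deriv (pgf X) (exp w)) has_field_derivative deriv (deriv (pgf X)) 1 * 1) (at (0::complex))"
        by (rule DERIV_chain2[OF _ e]) (use P'(2)[OF one] in simp)
      have b: "((\<lambda>w. pgf X (exp w)) has_field_derivative deriv (pgf X) 1 * 1) (at (0::complex))"
        by (rule DERIV_chain2[OF _ e]) (use P'(1)[OF one] in simp)
      show "((\<lambda>w. deriv (pgf X) (exp w) * exp w / pgf X (exp w)) has_field_derivative
         ((deriv (deriv (pgf X)) 1 * 1) * 1 + 1 * deriv (pgf X) 1) * 1 - deriv (pgf X) 1 * (deriv (pgf X) 1)) (at (0::complex))"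
        using DERIV_divide[OF DERIV_mult[OF a e] b] by simp
    qed
    also have "\<dots> = of_real (var X)"
      by (simp add: pgf_moments[OF X] algebra_simps power2_eq_square)
    finally show ?thesis .
  qed
  have \<phi>0: "\<phi> 0 = 0" "deriv \<phi> 0 = of_real (mean X)"
    using d1[OF zero] M0 by (simp_all add: \<phi>_def pgf_moments[OF X])
  obtain C where C: "C \<ge> 0" "\<And>w. norm w \<le> R / 2 \<Longrightarrow>
      norm (\<phi> w - (\<phi> 0 + deriv \<phi> 0 * w + deriv (deriv \<phi>) 0 * w\<^sup>2 / 2)) \<le> C * norm w ^ 3"
    using holomorphic_Taylor2[OF \<phi>_hol, of "R / 2"] R by auto
  show ?thesis
  proof (rule exI[of _ \<phi>], rule exI[of _ "R / 2"], rule exI[of _ C], intro conjI allI impI, goal_cases)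
    case 1 thus ?case using R by simp
  next
    case 2 thus ?case using C by simp
  next
    case 3
    have "exp (R / 2) \<le> exp R0" using R by simp
    thus ?case using R0 by simp
  next
    case (4 w)
    thus ?case using R by (intro exp_\<phi>) auto
  next
    case (5 w)
    show ?case using C(2)[OF 5] by (simp add: \<phi>0 d2)
  qed
qed

section \<open>The Gaussian integral and the function G3\<close>

text \<open>This is the majorant of the error: it is integrable over the line, with an integral of order \<open>1 / \<theta>\<close>.\<close>

lemma integral_inverse_quadratic:
  fixes \<theta> :: real
  assumes "\<theta> > 0"
  shows "integrable lborel (\<lambda>u. 1 / (\<theta>\<^sup>2 + u\<^sup>2))" "(LBINT u. 1 / (\<theta>\<^sup>2 + u\<^sup>2)) = pi / \<theta>"
proof -
  let ?F = "\<lambda>u. arctan (u / \<theta>) / \<theta>"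
  let ?f = "\<lambda>u. 1 / (\<theta>\<^sup>2 + u\<^sup>2)"
  have pos: "\<theta>\<^sup>2 + u\<^sup>2 > 0" for u using assms by (intro add_pos_nonneg) auto
  have D: "(?F has_field_derivative ?f u) (at u)" for u
  proof -
    have "(?F has_field_derivative (inverse (1 + (u / \<theta>)\<^sup>2) * (1 / \<theta>)) / \<theta>) (at u)"
      using assms by (auto intro!: derivative_eq_intros)
    also have "(inverse (1 + (u / \<theta>)\<^sup>2) * (1 / \<theta>)) / \<theta> = ?f u"
    proof -
      have "1 + (u / \<theta>)\<^sup>2 = (\<theta>\<^sup>2 + u\<^sup>2) / \<theta>\<^sup>2" using assms by (simp add: field_simps)
      thus ?thesis using assms by (simp add: power2_eq_square)
    qed
    finally show ?thesis .
  qed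
  have top: "(?F \<longlongrightarrow> pi / 2 / \<theta>) at_top"
  proof -
    have "filterlim (\<lambda>u. 1 / \<theta> * u) at_top at_top"
      using assms by (intro filterlim_tendsto_pos_mult_at_top[OF tendsto_const _ filterlim_ident]) auto
    hence "filterlim (\<lambda>u. u / \<theta>) at_top at_top" by simp
    thus ?thesis
      using assms by (intro tendsto_divide filterlim_compose[OF tendsto_arctan_at_top] tendsto_const) auto
  qed
  have bot: "(?F \<longlongrightarrow> - (pi / 2) / \<theta>) at_bot"
  proof -
    have "((\<lambda>u. ?F (- u)) \<longlongrightarrow> - (pi / 2) / \<theta>) at_top"
      using tendsto_minus[OF top] by (simp add: arctan_minus)
    thus ?thesis by (simp add: at_bot_mirror filterlim_filtermap)
  qed
  have "set_integrable lborel (einterval (-\<infinity>) \<infinity>) ?f" "(LBINT x=-\<infinity>..\<infinity>. ?f x) = pi / 2 / \<theta> - (- (pi / 2) / \<theta>)"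
    using pos top bot
    by (intro interval_integral_FTC_nonneg[where F = ?F] D; auto simp: ereal_tendsto_simps less_imp_le intro!: continuous_intros less_imp_neq[symmetric])+
  thus "integrable lborel ?f" "(LBINT u. ?f u) = pi / \<theta>"
    by (simp_all add: set_integrable_def interval_lebesgue_integral_def set_lebesgue_integral_def)
qed

text \<open>The inequalities follow from \<open>ln x \<le> x - 1\<close> and \<open>1 + v \<le> e^v\<close>. In heavy traffic \<open>v\<close> is small near \<open>u = 0\<close>, and a
bound in terms of \<open>1 / v\<close> gives up nothing essential there.\<close>

lemma neg_ln_one_minus_exp_bounds:
  fixes v :: real
  assumes "v > 0"
  shows "0 \<le> - ln (1 - exp (- v))" "- ln (1 - exp (- v)) \<le> 1 / v"
    and "exp (- v) / (1 - exp (- v)) = 1 / (exp v - 1)" "1 / (exp v - 1) \<le> 1 / v"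
proof -
  define x where "x = 1 - exp (- v)"
  have x: "0 < x" "x < 1" using assms by (auto simp: x_def)
  show "0 \<le> - ln (1 - exp (- v))" using x by (simp add: x_def[symmetric])
  show eq: "exp (- v) / (1 - exp (- v)) = 1 / (exp v - 1)"
    using assms by (simp add: exp_minus field_simps)
  have "exp v - 1 \<ge> v" using exp_ge_add_one_self[of v] by linarith
  thus le: "1 / (exp v - 1) \<le> 1 / v" using assms by (intro divide_left_mono) auto
  have "- ln x = ln (1 / x)" using x by (simp add: ln_div)
  also have "\<dots> \<le> 1 / x - 1" using x by (intro ln_le_minus_one) auto
  also have "\<dots> = exp (- v) / (1 - exp (- v))" using x by (simp add: x_def field_simps)
  finally show "- ln (1 - exp (- v)) \<le> 1 / v" using eq le by (simp add: x_def)
qed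

definition G3_integrand :: "real \<Rightarrow> real \<Rightarrow> real" where
  "G3_integrand b t = t\<^sup>2 / (b\<^sup>2 + t\<^sup>2)\<^sup>2 * (exp (- b\<^sup>2 - t\<^sup>2) / (1 - exp (- b\<^sup>2 - t\<^sup>2)))"

lemma G3_integrand_alt:
  assumes "b > 0"
  shows "G3_integrand b t = t\<^sup>2 / (b\<^sup>2 + t\<^sup>2)\<^sup>2 * (1 / (exp (b\<^sup>2 + t\<^sup>2) - 1))"
proof -
  have "b\<^sup>2 + t\<^sup>2 > 0" using assms by (intro add_pos_nonneg) auto
  from neg_ln_one_minus_exp_bounds(3)[OF this] show ?thesis
    by (simp add: G3_integrand_def)
qed

lemma G3_integrand_nonneg: "b > 0 \<Longrightarrow> G3_integrand b t \<ge> 0"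
  by (simp add: G3_integrand_alt)

lemma G3_integrand_measurable [measurable]: "G3_integrand b \<in> borel_measurable borel"
  unfolding G3_integrand_def[abs_def] by measurable

lemma G3_integrand_integrable:
  assumes "b > 0"
  shows "integrable lborel (G3_integrand b)"
proof (rule Bochner_Integration.integrable_bound)
  show "integrable lborel (\<lambda>t. 1 / b\<^sup>2 * (1 / (b\<^sup>2 + t\<^sup>2)))"
    by (intro integrable_mult_right integral_inverse_quadratic assms)
  show "AE t in lborel. norm (G3_integrand b t) \<le> norm (1 / b\<^sup>2 * (1 / (b\<^sup>2 + t\<^sup>2)))"
  proof (rule AE_I2)
    fix t
    have v: "b\<^sup>2 + t\<^sup>2 > 0" using assms by (intro add_pos_nonneg) auto
    have "G3_integrand b t \<le> (b\<^sup>2 + t\<^sup>2) / (b\<^sup>2 + t\<^sup>2)\<^sup>2 * (1 / b\<^sup>2)"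
      unfolding G3_integrand_alt[OF assms]
    proof (intro mult_mono divide_right_mono)
      have "1 / (exp (b\<^sup>2 + t\<^sup>2) - 1) \<le> 1 / (b\<^sup>2 + t\<^sup>2)"
        by (rule neg_ln_one_minus_exp_bounds(4)[OF v])
      also have "\<dots> \<le> 1 / b\<^sup>2" using assms v by (intro divide_left_mono) auto
      finally show "1 / (exp (b\<^sup>2 + t\<^sup>2) - 1) \<le> 1 / b\<^sup>2" .
    qed (use v in auto)
    also have "\<dots> = 1 / b\<^sup>2 * (1 / (b\<^sup>2 + t\<^sup>2))" using v by (simp add: power2_eq_square[of "b\<^sup>2 + t\<^sup>2"])
    finally show "norm (G3_integrand b t) \<le> norm (1 / b\<^sup>2 * (1 / (b\<^sup>2 + t\<^sup>2)))"
      using G3_integrand_nonneg[OF assms, of t] v by simp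
  qed
qed simp

lemma G3_eq: "G3 b = (LBINT t. indicator {0..} t * G3_integrand b t)"
  by (simp add: G3_def G3_integrand_def set_lebesgue_integral_def)

lemma integral_G3_integrand:
  assumes "b > 0"
  shows "(LBINT t. G3_integrand b t) = 2 * G3 b"
proof -
  let ?g = "G3_integrand b"
  have i: "integrable lborel (\<lambda>t. indicator {0..} t * ?g t)" "integrable lborel (\<lambda>t. indicator {..0} t * ?g t)"
    using G3_integrand_integrable[OF assms] by (auto intro!: integrable_real_mult_indicator simp: mult.commute)
  have "(LBINT t. indicator {..0} t * ?g t) = (LBINT t. indicator {..0} (0 + (-1) * t) * ?g (0 + (-1) * t))"
    by (subst lborel_integral_real_affine[where c = "-1" and t = 0]) auto
  also have "\<dots> = G3 b" unfolding G3_eq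
    by (intro Bochner_Integration.integral_cong) (auto simp: indicator_def G3_integrand_def)
  finally have *: "(LBINT t. indicator {..0} t * ?g t) = G3 b" .
  have "(LBINT t. ?g t) = (LBINT t. indicator {0..} t * ?g t + indicator {..0} t * ?g t)"
    by (intro Bochner_Integration.integral_cong) (auto simp: indicator_def G3_integrand_def)
  also have "\<dots> = G3 b + G3 b"
    by (subst Bochner_Integration.integral_add[OF i]) (simp add: * G3_eq)
  finally show ?thesis by simp
qed

text \<open>On \<open>[b / 2, b]\<close> the first factor of the integrand is at least \<open>1 / (16 b^2)\<close>, and the second is
\<open>1 / (e^v - 1) \<ge> 1 / (v e^v)\<close> with \<open>v = b^2 + t^2 \<le> 2 b^2\<close>. The order \<open>b^(-3)\<close> is the true one as \<open>b \<rightarrow> 0\<close>.\<close>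

lemma G3_lower_bound:
  assumes "0 < b" "b \<le> B"
  shows "exp (- 2 * B\<^sup>2) / (64 * b ^ 3) \<le> G3 b"
proof -
  define c where "c = 1 / (16 * b\<^sup>2) * (1 / (2 * b\<^sup>2 * exp (2 * B\<^sup>2)))"
  have c: "c \<ge> 0" by (simp add: c_def)
  have pt: "indicator {b/2..b} t * c \<le> indicator {0..} t * G3_integrand b t" for t
  proof (cases "t \<in> {b/2..b}")
    case True
    have v: "b\<^sup>2 + t\<^sup>2 > 0" using assms by (intro add_pos_nonneg) auto
    have t2: "t\<^sup>2 \<le> b\<^sup>2" using True assms by (intro power_mono) auto
    have t1: "(b / 2)\<^sup>2 \<le> t\<^sup>2" using True assms by (intro power_mono) auto
    have "1 / (16 * b\<^sup>2) = (b / 2)\<^sup>2 / (b\<^sup>2 + b\<^sup>2)\<^sup>2"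
      using assms by (simp add: power2_eq_square field_simps)
    also have "\<dots> \<le> t\<^sup>2 / (b\<^sup>2 + t\<^sup>2)\<^sup>2"
      using t2 v by (intro frac_le[OF _ t1] zero_less_power power_mono) auto
    finally have 1: "1 / (16 * b\<^sup>2) \<le> t\<^sup>2 / (b\<^sup>2 + t\<^sup>2)\<^sup>2" .
    define w where "w = b\<^sup>2 + t\<^sup>2"
    have w: "w > 0" "w \<le> 2 * b\<^sup>2" "2 * b\<^sup>2 \<le> 2 * B\<^sup>2" using v t2 assms by (auto simp: w_def intro!: power_mono)
    have "exp w - 1 \<le> w * exp w"
      using exp_ge_add_one_self[of "- w"] by (simp add: exp_minus field_simps)
    also have "\<dots> \<le> (2 * b\<^sup>2) * exp (2 * B\<^sup>2)" using w by (intro mult_mono) auto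
    finally have "1 / (2 * b\<^sup>2 * exp (2 * B\<^sup>2)) \<le> 1 / (exp w - 1)"
      using w assms by (intro divide_left_mono mult_pos_pos) auto
    hence "c \<le> t\<^sup>2 / (b\<^sup>2 + t\<^sup>2)\<^sup>2 * (1 / (exp w - 1))"
      unfolding c_def using 1 by (intro mult_mono) auto
    thus ?thesis using True assms by (simp add: G3_integrand_alt w_def)
  qed (use G3_integrand_nonneg[OF assms(1)] in auto)
  have "exp (- 2 * B\<^sup>2) / (64 * b ^ 3) = b / 2 * c"
    using assms by (simp add: c_def exp_minus field_simps power2_eq_square power3_eq_cube)
  also have "\<dots> = (LBINT t. indicator {b/2..b} t * c)" using assms by simp
  also have "\<dots> \<le> (LBINT t. indicator {0..} t * G3_integrand b t)"
  proof (rule integral_mono[OF _ _ pt])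
    show "integrable lborel (\<lambda>t. indicator {b/2..b} t * c)"
      by (intro integrable_mult_left integrable_real_indicator) (auto simp: emeasure_lborel_Icc_eq)
    show "integrable lborel (\<lambda>t. indicator {0..} t * G3_integrand b t)"
      using G3_integrand_integrable[OF assms(1)] by (auto intro!: integrable_real_mult_indicator simp: mult.commute)
  qed
  finally show ?thesis by (simp add: G3_eq)
qed

lemma norm_Complex_sq: "(norm (Complex \<theta> u))\<^sup>2 = \<theta>\<^sup>2 + u\<^sup>2"
  by (simp add: cmod_power2)

lemma Re_inverse_cube:
  assumes "\<theta> > 0"
  shows "Re (2 / Complex \<theta> u ^ 3) = (2 * \<theta> ^ 3 - 6 * \<theta> * u\<^sup>2) / (\<theta>\<^sup>2 + u\<^sup>2) ^ 3"
proof -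
  have "Re (2 / Complex \<theta> u ^ 3) = 2 * Re (Complex \<theta> u ^ 3) / (norm (Complex \<theta> u ^ 3))\<^sup>2"
    by (simp only: Re_divide) (simp add: cmod_power2)
  also have "(norm (Complex \<theta> u ^ 3))\<^sup>2 = (\<theta>\<^sup>2 + u\<^sup>2) ^ 3"
  proof -
    have "(norm (Complex \<theta> u ^ 3))\<^sup>2 = ((norm (Complex \<theta> u))\<^sup>2) ^ 3"
      by (simp add: norm_power flip: power_mult)
    thus ?thesis by (simp only: norm_Complex_sq)
  qed
  also have "Re (Complex \<theta> u ^ 3) = \<theta> ^ 3 - 3 * \<theta> * u\<^sup>2"
    by (simp add: power3_eq_cube power2_eq_square algebra_simps)
  finally show ?thesis by simp
qed

text \<open>Integration by parts: \<open>Re (2 / (\<theta> + \<i> u)^3)\<close> is the derivative of \<open>P u = 2 \<theta> u / (\<theta>^2 + u^2)^2\<close>, and the derivative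
of the logarithm is \<open>- 2 a u / (e^v - 1)\<close> with \<open>v = a (\<theta>^2 + u^2)\<close>. The product of this with \<open>P u\<close> is the integrand of
\<open>G3\<close> after the substitution \<open>t = u \<surd>a\<close>; it is even in \<open>u\<close>, so the integral over the line is twice the one in \<open>G3\<close>.\<close>

lemma gaussian_main_term:
  fixes a \<theta> :: real
  assumes a: "a > 0" and \<theta>: "\<theta> > 0"
  defines "\<Lambda> \<equiv> \<lambda>u. - ln (1 - exp (- (a * (\<theta>\<^sup>2 + u\<^sup>2))))"
  shows "integrable lborel (\<lambda>u. \<Lambda> u * Re (2 / Complex \<theta> u ^ 3))"
    and "(LBINT u. \<Lambda> u * Re (2 / Complex \<theta> u ^ 3)) = 8 * \<theta> * (a * sqrt a) * G3 (\<theta> * sqrt a)"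
proof -
  define q where "q = (\<lambda>u. \<theta>\<^sup>2 + u\<^sup>2)"
  have q: "q u > 0" for u unfolding q_def using \<theta> by (intro add_pos_nonneg) auto
  have aq: "a * q u > 0" for u using a q by simp
  have q\<theta>: "\<theta>\<^sup>2 \<le> q u" for u by (simp add: q_def)
  define P where "P = (\<lambda>u. 2 * \<theta> * u / (q u)\<^sup>2)"
  define P' where "P' = (\<lambda>u. Re (2 / Complex \<theta> u ^ 3))"
  define R where "R = (\<lambda>u. 1 / (exp (a * q u) - 1))"
  have P': "(P has_field_derivative P' u) (at u)" for u
  proof -
    have "(P has_field_derivative (2 * \<theta> * (q u)\<^sup>2 - 2 * \<theta> * u * (2 * q u * (2 * u))) / ((q u)\<^sup>2 * (q u)\<^sup>2)) (at u)"
      unfolding P_def using q[of u] unfolding q_def by (auto intro!: derivative_eq_intros)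
    also have "(2 * \<theta> * (q u)\<^sup>2 - 2 * \<theta> * u * (2 * q u * (2 * u))) / ((q u)\<^sup>2 * (q u)\<^sup>2) = P' u"
    proof -
      have "2 * \<theta> * (q u)\<^sup>2 - 2 * \<theta> * u * (2 * q u * (2 * u)) = q u * (2 * \<theta> ^ 3 - 6 * \<theta> * u\<^sup>2)"
        by (simp add: q_def algebra_simps power2_eq_square power3_eq_cube)
      moreover have "(q u)\<^sup>2 * (q u)\<^sup>2 = q u * (q u) ^ 3" by (simp add: power2_eq_square power3_eq_cube)
      moreover have "P' u = (2 * \<theta> ^ 3 - 6 * \<theta> * u\<^sup>2) / q u ^ 3"
        by (simp add: P'_def Re_inverse_cube[OF \<theta>] q_def)
      ultimately show ?thesis using q[of u]
        by (simp only: nonzero_mult_divide_mult_cancel_left[OF less_imp_neq[OF q[of u], symmetric]])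
    qed
    finally show ?thesis .
  qed
  have \<Lambda>': "(\<Lambda> has_field_derivative - (2 * a * u) * R u) (at u)" for u
  proof -
    have lt: "exp (- (a * q u)) < 1" using aq[of u] by simp
    have "(\<Lambda> has_field_derivative - ((exp (- (a * q u)) * (a * (2 * u))) / (1 - exp (- (a * q u))))) (at u)"
      unfolding \<Lambda>_def using lt unfolding q_def by (auto intro!: derivative_eq_intros)
    also have "- ((exp (- (a * q u)) * (a * (2 * u))) / (1 - exp (- (a * q u)))) =
               - (2 * a * u) * (exp (- (a * q u)) / (1 - exp (- (a * q u))))" by simp
    also have "exp (- (a * q u)) / (1 - exp (- (a * q u))) = R u"
      unfolding R_def by (rule neg_ln_one_minus_exp_bounds(3)[OF aq])
    finally show ?thesis .
  qed
  have \<Lambda>_bd: "\<bar>\<Lambda> u\<bar> \<le> 1 / (a * \<theta>\<^sup>2)" and R_bd: "\<bar>R u\<bar> \<le> 1 / (a * \<theta>\<^sup>2)" for u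
  proof -
    have le: "1 / (a * q u) \<le> 1 / (a * \<theta>\<^sup>2)" using a q \<theta> q\<theta> aq by (intro divide_left_mono mult_left_mono) auto
    show "\<bar>\<Lambda> u\<bar> \<le> 1 / (a * \<theta>\<^sup>2)" using neg_ln_one_minus_exp_bounds(1,2)[OF aq[of u]] le
      by (simp add: \<Lambda>_def q_def)
    show "\<bar>R u\<bar> \<le> 1 / (a * \<theta>\<^sup>2)" using neg_ln_one_minus_exp_bounds(4)[OF aq[of u]] le aq[of u]
      by (simp add: R_def)
  qed
  have P_bd: "\<bar>P u\<bar> \<le> 1 / q u" for u
  proof -
    have "0 \<le> (\<theta> - \<bar>u\<bar>)\<^sup>2" by simp
    hence "2 * \<theta> * \<bar>u\<bar> \<le> q u" by (simp add: q_def power2_diff)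
    hence "2 * \<theta> * \<bar>u\<bar> / (q u)\<^sup>2 \<le> q u / (q u)\<^sup>2" by (intro divide_right_mono) auto
    thus ?thesis using \<theta> q[of u] by (simp add: P_def abs_mult power2_eq_square[of "q u"])
  qed
  have P'_bd: "\<bar>P' u\<bar> \<le> 2 / \<theta> * (1 / q u)" for u
  proof -
    have n: "norm (Complex \<theta> u) \<ge> \<theta>" using complex_Re_le_cmod[of "Complex \<theta> u"] by simp
    have "\<bar>P' u\<bar> \<le> norm (2 / Complex \<theta> u ^ 3)" unfolding P'_def by (rule abs_Re_le_cmod)
    also have "\<dots> = 2 / (norm (Complex \<theta> u) * q u)"
    proof -
      have "norm (Complex \<theta> u) ^ 3 = norm (Complex \<theta> u) * q u"
        unfolding q_def norm_Complex_sq[symmetric] by (simp add: power2_eq_square power3_eq_cube)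
      thus ?thesis by (simp add: norm_divide norm_power)
    qed
    also have "\<dots> \<le> 2 / (\<theta> * q u)" using n q[of u] \<theta> by (intro divide_left_mono mult_right_mono mult_pos_pos) auto
    finally show ?thesis by simp
  qed
  have iq: "integrable lborel (\<lambda>u. c * (1 / q u))" for c
    unfolding q_def by (intro integrable_mult_right integral_inverse_quadratic \<theta>)
  have contq: "continuous_on UNIV q" unfolding q_def by (intro continuous_intros)
  have cont1: "isCont (\<lambda>u. \<Lambda> u * P' u) u" for u
  proof -
    have "isCont P' u" unfolding P'_def Re_inverse_cube[OF \<theta>] using q[of u] by (auto simp: q_def intro!: continuous_intros)
    thus ?thesis using DERIV_isCont[OF \<Lambda>'[of u]] by (intro isCont_mult)
  qed
  have cont2: "isCont (\<lambda>u. - (2 * a * u) * R u * P u) u" for u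
    unfolding R_def using DERIV_isCont[OF P'[of u]] aq[of u]
    by (auto simp: q_def intro!: continuous_intros)
  have meas: "f \<in> borel_measurable borel" if "\<And>u. isCont f u" for f :: "real \<Rightarrow> real"
    using that by (intro borel_measurable_continuous_onI continuous_at_imp_continuous_on) auto
  have i1: "integrable lborel (\<lambda>u. \<Lambda> u * P' u)"
  proof (rule Bochner_Integration.integrable_bound[OF iq[of "1 / (a * \<theta>\<^sup>2) * (2 / \<theta>)"]])
    show "AE u in lborel. norm (\<Lambda> u * P' u) \<le> norm (1 / (a * \<theta>\<^sup>2) * (2 / \<theta>) * (1 / q u))"
    proof (rule AE_I2)
      fix u
      have "\<bar>\<Lambda> u\<bar> * \<bar>P' u\<bar> \<le> 1 / (a * \<theta>\<^sup>2) * (2 / \<theta> * (1 / q u))"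
        using a \<theta> by (intro mult_mono \<Lambda>_bd P'_bd) auto
      thus "norm (\<Lambda> u * P' u) \<le> norm (1 / (a * \<theta>\<^sup>2) * (2 / \<theta>) * (1 / q u))"
        using a \<theta> q[of u] by (simp add: abs_mult)
    qed
  qed (use meas[OF cont1] in simp)
  have i2': "integrable lborel (\<lambda>u. 4 * \<theta> * (a * a) * G3_integrand (\<theta> * sqrt a) (sqrt a * u))"
    using G3_integrand_integrable[of "\<theta> * sqrt a"] a \<theta>
    by (intro integrable_mult_right) (auto intro!: lborel_integrable_real_affine[where t = 0, simplified])
  have i2eq: "- (2 * a * u) * R u * P u = - (4 * \<theta> * (a * a) * G3_integrand (\<theta> * sqrt a) (sqrt a * u))" for u
  proof -
    have s: "(\<theta> * sqrt a)\<^sup>2 + (sqrt a * u)\<^sup>2 = a * q u"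
      using a by (simp add: q_def power_mult_distrib algebra_simps)
    have "G3_integrand (\<theta> * sqrt a) (sqrt a * u) = (sqrt a * u)\<^sup>2 / (a * q u)\<^sup>2 * R u"
      using a \<theta> by (subst G3_integrand_alt) (auto simp: s R_def)
    also have "(sqrt a * u)\<^sup>2 / (a * q u)\<^sup>2 = u\<^sup>2 / (a * (q u)\<^sup>2)"
      using a by (simp add: power_mult_distrib power2_eq_square[of a])
    finally show ?thesis using a by (simp add: P_def power2_eq_square[of u])
  qed
  have i2: "integrable lborel (\<lambda>u. - (2 * a * u) * R u * P u)"
    unfolding i2eq using i2' by (rule Bochner_Integration.integrable_minus)
  have DF: "((\<lambda>u. \<Lambda> u * P u) has_vector_derivative (\<Lambda> u * P' u + - (2 * a * u) * R u * P u)) (at u)" for u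
    using DERIV_mult[OF \<Lambda>'[of u] P'[of u]]
    by (simp add: has_real_derivative_iff_has_vector_derivative[symmetric] algebra_simps)
  have lim: "((\<lambda>u. \<Lambda> u * P u) \<longlongrightarrow> 0) F" if F: "filterlim (\<lambda>u. q u) at_top F" for F
  proof (rule Lim_null_comparison)
    show "((\<lambda>u. 1 / (a * \<theta>\<^sup>2) * (1 / q u)) \<longlongrightarrow> 0) F"
      using F by (intro tendsto_mult_right_zero tendsto_divide_0[OF tendsto_const] filterlim_at_top_imp_at_infinity)
    have "norm (\<Lambda> u * P u) \<le> 1 / (a * \<theta>\<^sup>2) * (1 / q u)" for u
      unfolding real_norm_def abs_mult using a by (intro mult_mono \<Lambda>_bd P_bd) auto
    thus "eventually (\<lambda>u. norm (\<Lambda> u * P u) \<le> 1 / (a * \<theta>\<^sup>2) * (1 / q u)) F" by simp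
  qed
  have qt1: "filterlim q at_top at_top"
    unfolding q_def power2_eq_square
    by (intro filterlim_tendsto_add_at_top[OF tendsto_const] filterlim_at_top_mult_at_top filterlim_ident)
  hence "filterlim (\<lambda>u. q (- u)) at_top at_top" by (simp add: q_def)
  hence qt2: "filterlim q at_top at_bot" by (simp add: at_bot_mirror filterlim_filtermap)
  have "(LBINT x=-\<infinity>..\<infinity>. \<Lambda> x * P' x + - (2 * a * x) * R x * P x) = 0 - 0"
  proof (rule interval_integral_FTC_integrable[where F = "\<lambda>u. \<Lambda> u * P u"])
    show "set_integrable lborel (einterval (- \<infinity>) \<infinity>) (\<lambda>x. \<Lambda> x * P' x + - (2 * a * x) * R x * P x)"
      unfolding set_integrable_def using i1 i2 by (auto intro!: Bochner_Integration.integrable_add)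
    show "isCont (\<lambda>x. \<Lambda> x * P' x + - (2 * a * x) * R x * P x) u" for u
      by (rule isCont_add[OF cont1 cont2])
    show "(((\<lambda>u. \<Lambda> u * P u) \<circ> real_of_ereal) \<longlongrightarrow> 0) (at_right (- \<infinity>))"
      using lim[OF qt2] by (simp add: ereal_tendsto_simps)
    show "(((\<lambda>u. \<Lambda> u * P u) \<circ> real_of_ereal) \<longlongrightarrow> 0) (at_left \<infinity>)"
      using lim[OF qt1] by (simp add: ereal_tendsto_simps)
  qed (use DF in simp_all)
  hence "(LBINT u. \<Lambda> u * P' u + - (2 * a * u) * R u * P u) = 0"
    by (simp add: interval_lebesgue_integral_def set_lebesgue_integral_def)
  hence "(LBINT u. \<Lambda> u * P' u) = - (LBINT u. - (2 * a * u) * R u * P u)"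
    by (subst (asm) Bochner_Integration.integral_add[OF i1 i2]) simp
  also have "\<dots> = 4 * \<theta> * (a * a) * (LBINT u. G3_integrand (\<theta> * sqrt a) (sqrt a * u))"
    unfolding i2eq by simp
  also have "(LBINT u. G3_integrand (\<theta> * sqrt a) (sqrt a * u)) = (2 * G3 (\<theta> * sqrt a)) / sqrt a"
  proof -
    have "2 * G3 (\<theta> * sqrt a) = \<bar>sqrt a\<bar> *\<^sub>R (LBINT u. G3_integrand (\<theta> * sqrt a) (0 + sqrt a * u))"
      using a \<theta> by (subst integral_G3_integrand[symmetric], simp, subst lborel_integral_real_affine[where c = "sqrt a" and t = 0]) auto
    thus ?thesis using a by simp
  qed
  also have "4 * \<theta> * (a * a) * ((2 * G3 (\<theta> * sqrt a)) / sqrt a) = 8 * \<theta> * (a * sqrt a) * G3 (\<theta> * sqrt a)"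
  proof -
    have "a * (a / sqrt a) = a * sqrt a" using a by (simp only: real_div_sqrt[OF less_imp_le[OF a]])
    hence "a * a / sqrt a = a * sqrt a" by simp
    hence "8 * \<theta> * (a * a / sqrt a) * G3 (\<theta> * sqrt a) = 8 * \<theta> * (a * sqrt a) * G3 (\<theta> * sqrt a)" by (simp only:)
    thus ?thesis by simp
  qed
  finally show "(LBINT u. \<Lambda> u * Re (2 / Complex \<theta> u ^ 3)) = 8 * \<theta> * (a * sqrt a) * G3 (\<theta> * sqrt a)"
    by (simp add: P'_def)
  show "integrable lborel (\<lambda>u. \<Lambda> u * Re (2 / Complex \<theta> u ^ 3))" using i1 by (simp add: P'_def)
qed

section \<open>Comparison with the Gaussian integral\<close>

text \<open>On the half-plane \<open>Re y \<ge> v / 2\<close>, which contains both points, the derivative of \<open>Ln (1 - e^(-y))\<close> has modulus at most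
\<open>1 / (e^(v/2) - 1) \<le> 2 / v\<close>.\<close>

lemma Ln_one_minus_exp_lipschitz:
  fixes x :: complex and v :: real
  assumes v: "v > 0" and x: "norm (x - of_real v) \<le> v / 2"
  shows "norm (Ln (1 - exp (- x)) - of_real (ln (1 - exp (- v)))) \<le> 2 / v * norm (x - of_real v)"
proof -
  define S where "S = {y. Re y \<ge> v / 2}"
  have norm_lt: "norm (exp (- y)) < 1" if "y \<in> S" for y using that v by (simp add: S_def)
  have slit: "1 - exp (- y) \<notin> \<real>\<^sub>\<le>\<^sub>0" if "y \<in> S" for y
  proof
    assume "1 - exp (- y) \<in> \<real>\<^sub>\<le>\<^sub>0"
    hence "Re (1 - exp (- y)) \<le> 0" by (simp add: complex_nonpos_Reals_iff)
    thus False using norm_lt[OF that] complex_Re_le_cmod[of "exp (- y)"] by simp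
  qed
  have "norm (Ln (1 - exp (- x)) - Ln (1 - exp (- of_real v))) \<le> 2 / v * norm (x - of_real v)"
  proof (rule field_differentiable_bound[where S = S])
    show "convex S" unfolding S_def by (rule convex_halfspace_Re_ge)
    show "((\<lambda>y. Ln (1 - exp (- y))) has_field_derivative inverse (1 - exp (- y)) * exp (- y)) (at y within S)"
      if "y \<in> S" for y
    proof -
      have "((\<lambda>y. 1 - exp (- y)) has_field_derivative exp (- y)) (at y within S)"
        by (auto intro!: derivative_eq_intros)
      from DERIV_chain2[where f = Ln and g = "\<lambda>y. 1 - exp (- y)", OF has_field_derivative_Ln[OF slit[OF that]] this]
      show ?thesis .
    qed
    show "norm (inverse (1 - exp (- y)) * exp (- y)) \<le> 2 / v" if "y \<in> S" for y
    proof -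
      have y: "Re y > 0" "Re y \<ge> v / 2" using that v by (auto simp: S_def)
      have "1 - exp (- Re y) \<le> norm (1 - exp (- y))"
        using norm_triangle_ineq2[of 1 "exp (- y)"] by simp
      moreover have "1 - exp (- Re y) > 0" using y by simp
      ultimately have "exp (- Re y) / norm (1 - exp (- y)) \<le> exp (- Re y) / (1 - exp (- Re y))"
        by (intro frac_le) auto
      hence "norm (inverse (1 - exp (- y)) * exp (- y)) \<le> exp (- Re y) / (1 - exp (- Re y))"
        by (simp add: norm_mult norm_inverse divide_inverse mult.commute)
      also have "\<dots> \<le> 1 / Re y" using neg_ln_one_minus_exp_bounds(3,4)[OF y(1)] by simp
      also have "\<dots> \<le> 1 / (v / 2)" using y v by (intro divide_left_mono) auto
      finally show ?thesis by simp
    qed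
    have "\<bar>Re (x - of_real v)\<bar> \<le> v / 2" using abs_Re_le_cmod[of "x - of_real v"] x by linarith
    hence "- Re (x - of_real v) \<le> v / 2" using abs_ge_minus_self order.trans by blast
    thus "x \<in> S" by (simp add: S_def)
    show "of_real v \<in> S" using v by (simp add: S_def)
  qed
  moreover have "Ln (1 - exp (- of_real v)) = of_real (ln (1 - exp (- v)))"
  proof -
    have "1 - exp (- v) > 0" using v by simp
    from Ln_of_real[OF this] show ?thesis by (simp flip: exp_of_real)
  qed
  ultimately show ?thesis by simp
qed

text \<open>On the arc of the unit circle away from 1 the modulus of the generating function has a maximum below 1; by uniform
continuity circles of slightly larger radius inherit the bound.\<close>

lemma pgf_bound_off_axis:
  fixes X :: "nat pmf"
  assumes X: "summable (\<lambda>j. pmf X j * R ^ j)" "R > 1"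
    and circle: "\<And>z :: complex. norm z = 1 \<Longrightarrow> z \<noteq> 1 \<Longrightarrow> norm (pgf X z) < 1"
    and h: "0 < h" "h \<le> pi"
  shows "\<exists>q \<theta>1. 0 < q \<and> q < 1 \<and> 0 < \<theta>1 \<and> (\<forall>\<theta> u. 0 \<le> \<theta> \<longrightarrow> \<theta> \<le> \<theta>1 \<longrightarrow> h \<le> \<bar>u\<bar> \<longrightarrow> \<bar>u\<bar> \<le> pi \<longrightarrow>
           norm (pgf X (exp (Complex \<theta> u))) \<le> (q :: real))"
proof -
  define K where "K = {- pi..- h} \<union> {h..pi}"
  have K: "compact K" "K \<noteq> {}" using h by (auto simp: K_def)
  have cont: "continuous_on (ball 0 R) (pgf X :: complex \<Rightarrow> complex)"
    by (intro holomorphic_on_imp_continuous_on pgf_holomorphic X)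
  have "continuous_on K (\<lambda>u. norm (pgf X (cis u)))"
    by (intro continuous_on_norm continuous_on_compose2[OF cont]) (use X in \<open>auto intro!: continuous_intros\<close>)
  then obtain u0 where u0: "u0 \<in> K" "\<And>u. u \<in> K \<Longrightarrow> norm (pgf X (cis u)) \<le> norm (pgf X (cis u0))"
    using continuous_attains_sup[OF K] by blast
  define q0 where "q0 = norm (pgf X (cis u0))"
  have "cis u0 \<noteq> 1"
  proof
    assume "cis u0 = 1"
    hence "exp (\<i> * of_real u0) = 1" by (simp add: cis_conv_exp)
    then obtain m :: int where m: "u0 = of_int (2 * m) * pi" by (auto simp: exp_eq_1)
    have "\<bar>u0\<bar> \<le> pi" "u0 \<noteq> 0" using u0 h by (auto simp: K_def)
    hence "\<bar>real_of_int (2 * m)\<bar> * pi \<le> 1 * pi" "m \<noteq> 0" using m by (auto simp: abs_mult)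
    thus False by (subst (asm) mult_le_cancel_right) auto
  qed
  hence q0: "q0 < 1" "q0 \<ge> 0" using circle[of "cis u0"] by (auto simp: q0_def)
  define q where "q = (1 + q0) / 2"
  have q: "0 < q" "q < 1" "q0 < q" using q0 by (auto simp: q_def)
  define R' where "R' = (1 + R) / 2"
  have R': "1 < R'" "R' < R" using X by (auto simp: R'_def)
  have "continuous_on (cball 0 R') (pgf X :: complex \<Rightarrow> complex)"
    using cont by (rule continuous_on_subset) (use R' in auto)
  hence "uniformly_continuous_on (cball 0 R') (pgf X :: complex \<Rightarrow> complex)"
    by (intro compact_uniformly_continuous) auto
  moreover have "q - q0 > 0" using q by simp
  ultimately have "\<exists>d>0. \<forall>x\<in>cball (0::complex) R'. \<forall>y\<in>cball 0 R'. dist y x < d \<longrightarrow> dist (pgf X y) (pgf X x) < q - q0"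
    unfolding uniformly_continuous_on_def by blast
  then obtain d where d: "d > 0" "\<And>x y :: complex. x \<in> cball 0 R' \<Longrightarrow> y \<in> cball 0 R' \<Longrightarrow> dist y x < d \<Longrightarrow> dist (pgf X y) (pgf X x) < q - q0"
    by blast
  define \<theta>1 where "\<theta>1 = ln (min R' (1 + d / 2))"
  have \<theta>1: "\<theta>1 > 0" "exp \<theta>1 \<le> R'" "exp \<theta>1 < 1 + d"
    using R' d by (auto simp: \<theta>1_def min_def)
  show ?thesis
  proof (rule exI[of _ q], rule exI[of _ \<theta>1], intro conjI allI impI q \<theta>1)
    fix \<theta> u :: real assume as: "0 \<le> \<theta>" "\<theta> \<le> \<theta>1" "h \<le> \<bar>u\<bar>" "\<bar>u\<bar> \<le> pi"
    have e: "exp (Complex \<theta> u) = of_real (exp \<theta>) * cis u" by (simp add: exp_eq_polar)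
    have "exp \<theta> \<le> exp \<theta>1" "1 \<le> exp \<theta>" using as by simp_all
    hence e\<theta>: "1 \<le> exp \<theta>" "exp \<theta> \<le> R'" "exp \<theta> < 1 + d" using \<theta>1 by linarith+
    have "dist (exp (Complex \<theta> u)) (cis u) = norm (of_real (exp \<theta> - 1) * cis u)"
      unfolding e dist_norm by (simp add: algebra_simps)
    also have "\<dots> = exp \<theta> - 1" using e\<theta> by (simp only: norm_mult norm_of_real norm_cis) simp
    finally have "dist (exp (Complex \<theta> u)) (cis u) < d" using e\<theta> by simp
    hence "dist (pgf X (exp (Complex \<theta> u))) (pgf X (cis u)) < q - q0"
      using e\<theta> R' by (intro d) (auto simp: e norm_mult)
    moreover have "norm (pgf X (cis u)) \<le> q0"
      unfolding q0_def using as by (intro u0) (auto simp: K_def)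
    ultimately show "norm (pgf X (exp (Complex \<theta> u))) \<le> q"
      using norm_triangle_sub[of "pgf X (exp (Complex \<theta> u))" "pgf X (cis u)"] unfolding dist_norm by linarith
  qed
qed

text \<open>The quadratic part of \<open>s w - n log X(e^w)\<close> is \<open>a w (2 \<theta> - w)\<close> with \<open>a = s \<sigma>\<^sup>2 / (2 \<mu>)\<close>, except that \<open>n\<close> replaces
\<open>s / \<mu>\<close> in the coefficient of \<open>w^2\<close>; this costs \<open>a (\<sigma>\<^sup>2 / \<mu>) \<theta> |w|^2\<close>. For \<open>\<theta> \<le> 2 |w|\<close> that is again cubic in
\<open>|w|\<close>, like the Taylor remainder. On the line \<open>w = \<theta> + \<i> u\<close> the quadratic part equals
\<open>a (\<theta>\<^sup>2 + u\<^sup>2)\<close>, which is real. The weaker condition \<open>\<theta> \<le> 2 |w|\<close> instead of \<open>\<theta> \<le> |w|\<close> admits the real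
points \<open>w \<ge> \<theta> / 2\<close>, where the estimate shows that \<open>G\<close> is below 1 on an annulus.\<close>

lemma tilted_exponent:
  fixes X :: "nat pmf"
  assumes X: "summable (\<lambda>j. pmf X j * R ^ j)" "R > 1" and \<mu>: "mean X > 0" and v: "var X > 0"
  shows "\<exists>\<eta> C. 0 < \<eta> \<and> 0 < C \<and> exp \<eta> \<le> R \<and>
    (\<forall>n s \<theta> (w :: complex). 0 < \<theta> \<longrightarrow> real s - real n * mean X = \<theta> * var X * real s / mean X \<longrightarrow>
       norm w \<le> \<eta> \<longrightarrow> \<theta> \<le> 2 * norm w \<longrightarrow>
       (\<exists>V. pgf X (exp w) ^ n / exp w ^ s = exp (- V) \<and>
          norm (V - of_real (real s * var X / (2 * mean X)) * (w * (2 * of_real \<theta> - w))) \<le>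
            real s * var X / (2 * mean X) * (C * norm w ^ 3)))"
proof -
  define \<mu> where "\<mu> = mean X"
  define \<sigma>2 where "\<sigma>2 = var X"
  have pos: "\<mu> > 0" "\<sigma>2 > 0" using \<mu> v by (simp_all add: \<mu>_def \<sigma>2_def)
  obtain \<phi> :: "complex \<Rightarrow> complex" and \<eta> C where \<eta>: "\<eta> > 0" "C \<ge> 0" "exp \<eta> \<le> R"
    and \<phi>: "\<And>w. norm w \<le> \<eta> \<Longrightarrow> pgf X (exp w) = exp (\<phi> w)"
    and rem: "\<And>w. norm w \<le> \<eta> \<Longrightarrow> norm (\<phi> w - (of_real \<mu> * w + of_real \<sigma>2 * w\<^sup>2 / 2)) \<le> C * norm w ^ 3"
    using cumulant_expansion[OF X] unfolding \<mu>_def \<sigma>2_def by blast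
  define C1 where "C1 = 2 * \<sigma>2 / \<mu> + 2 * C / \<sigma>2"
  have C1: "C1 > 0" using pos \<eta> by (auto simp: C1_def intro!: add_pos_nonneg)
  have "\<exists>V. pgf X (exp w) ^ n / exp w ^ s = exp (- V) \<and>
          norm (V - of_real (real s * \<sigma>2 / (2 * \<mu>)) * (w * (2 * of_real \<theta> - w))) \<le>
            real s * \<sigma>2 / (2 * \<mu>) * (C1 * norm w ^ 3)"
    if \<theta>: "0 < \<theta>" "real s - real n * \<mu> = \<theta> * \<sigma>2 * real s / \<mu>" and w: "norm w \<le> \<eta>" "\<theta> \<le> 2 * norm w"
    for n s :: nat and \<theta> and w :: complex
  proof (intro exI conjI)
    define a where "a = real s * \<sigma>2 / (2 * \<mu>)"
    have a: "a \<ge> 0" using pos by (simp add: a_def)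
    define r where "r = \<phi> w - (of_real \<mu> * w + of_real \<sigma>2 * w\<^sup>2 / 2)"
    let ?V = "of_nat s * w - of_nat n * \<phi> w"
    show "pgf X (exp w) ^ n / exp w ^ s = exp (- ?V)"
      using \<phi>[OF w(1)] by (simp add: exp_diff exp_of_nat_mult)
    have s: "real s = 2 * \<mu> * a / \<sigma>2" using pos by (simp add: a_def)
    have sn: "real n * \<mu> = real s - 2 * \<theta> * a" using \<theta> pos by (simp add: a_def field_simps)
    have n\<sigma>: "real n * \<sigma>2 = 2 * a - 2 * \<theta> * a * \<sigma>2 / \<mu>"
    proof -
      have "real n * \<sigma>2 = (real n * \<mu>) * \<sigma>2 / \<mu>" using pos by simp
      also have "\<dots> = 2 * a - 2 * \<theta> * a * \<sigma>2 / \<mu>"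
        unfolding sn s using pos by (simp add: field_simps)
      finally show ?thesis .
    qed
    have n_le: "real n \<le> 2 * a / \<sigma>2"
    proof -
      have "real n * \<sigma>2 \<le> 2 * a" unfolding n\<sigma> using \<theta> a pos by simp
      thus ?thesis using pos by (simp add: field_simps)
    qed
    define t where "t = \<theta> * a * \<sigma>2 / \<mu>"
    have nt: "real n * \<sigma>2 = 2 * (a - t)" unfolding n\<sigma> t_def by simp
    have "?V = of_real (real s) * w - of_real (real n * \<mu>) * w - of_real (real n * \<sigma>2) * w\<^sup>2 / 2 - of_nat n * r"
      by (simp add: r_def algebra_simps)
    also have "\<dots> = of_real a * (w * (2 * of_real \<theta> - w)) + of_real t * w\<^sup>2 - of_nat n * r"
      unfolding nt sn by (simp add: field_simps power2_eq_square)
    finally have V: "?V - of_real a * (w * (2 * of_real \<theta> - w)) = of_real (\<theta> * a * \<sigma>2 / \<mu>) * w\<^sup>2 - of_nat n * r"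
      by (simp add: t_def)
    have "norm (?V - of_real a * (w * (2 * of_real \<theta> - w))) \<le> \<theta> * a * \<sigma>2 / \<mu> * (norm w)\<^sup>2 + real n * norm r"
      unfolding V using norm_triangle_ineq4[of "of_real (\<theta> * a * \<sigma>2 / \<mu>) * w\<^sup>2" "of_nat n * r"] \<theta> a pos
      by (simp add: norm_mult norm_power norm_divide)
    also have "real n * norm r \<le> (2 * a / \<sigma>2) * (C * norm w ^ 3)"
      unfolding r_def using n_le rem[OF w(1)] a pos by (intro mult_mono) auto
    also have "\<theta> * a * \<sigma>2 / \<mu> * (norm w)\<^sup>2 \<le> (2 * norm w) * a * \<sigma>2 / \<mu> * (norm w)\<^sup>2"
      using w a pos by (intro mult_right_mono divide_right_mono) auto
    also have "(2 * norm w) * a * \<sigma>2 / \<mu> * (norm w)\<^sup>2 + (2 * a / \<sigma>2) * (C * norm w ^ 3) = a * (C1 * norm w ^ 3)"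
      by (simp add: C1_def algebra_simps power2_eq_square power3_eq_cube)
    finally show "norm (?V - of_real (real s * \<sigma>2 / (2 * \<mu>)) * (w * (2 * of_real \<theta> - w))) \<le>
            real s * \<sigma>2 / (2 * \<mu>) * (C1 * norm w ^ 3)"
      by (simp add: a_def)
  qed
  thus ?thesis
    unfolding \<mu>_def[symmetric] \<sigma>2_def[symmetric] using \<eta> C1 by blast
qed

text \<open>Here \<open>\<theta> = (\<mu> / \<sigma>\<^sup>2) (1 - \<rho>)\<close>, and the bound is uniform over all \<open>n\<close> and \<open>s\<close> with the same small \<open>\<theta>\<close>. With \<open>w = \<theta> + \<i> u\<close> and \<open>v = a |w|^2\<close>, the exact integrand \<open>f\<close> is compared with the Gaussian one on three
ranges of \<open>u\<close>. For \<open>|u| \<le> h\<close> the exponents differ by \<open>O(a |w|^3)\<close>, so the logarithms differ by \<open>O(a |w|^3 / v) = O(|w|)\<close>,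
and multiplication by \<open>2 / |w|^3\<close> leaves \<open>O(1 / |w|^2)\<close>; replacing the kernel costs
\<open>O(1 / v + |w|)\<close>, which is no larger since \<open>a\<close> is bounded below. For \<open>h \<le> |u| \<le> \<pi>\<close>
both integrands are bounded, and for \<open>|u| > \<pi>\<close> only the Gaussian tail remains. In all cases the difference is
\<open>O(1 / (\<theta>\<^sup>2 + u\<^sup>2))\<close>.\<close>

lemma uniform_heavy_traffic:
  fixes X :: "nat pmf"
  assumes X: "summable (\<lambda>j. pmf X j * R ^ j)" "R > 1" and \<mu>: "mean X > 0" and v: "var X > 0"
    and circle: "\<And>z :: complex. norm z = 1 \<Longrightarrow> z \<noteq> 1 \<Longrightarrow> norm (pgf X z) < 1"
  obtains \<theta>0 D where "0 < \<theta>0" "0 \<le> D"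
    and "\<And>n s \<theta> a Q. n \<ge> 1 \<Longrightarrow> s \<ge> 1 \<Longrightarrow> 0 < \<theta> \<Longrightarrow> \<theta> \<le> \<theta>0 \<Longrightarrow>
      real s - real n * mean X = \<theta> * var X * real s / mean X \<Longrightarrow>
      a = real s * var X / (2 * mean X) \<Longrightarrow>
      Q = map_pmf (\<lambda>b. b - s) (map_pmf (\<lambda>(q, a). q + a) (pair_pmf Q (demand X n))) \<Longrightarrow>
      \<bar>var Q - 4 * \<theta> * (a * sqrt a) / pi * G3 (\<theta> * sqrt a)\<bar> \<le> D / \<theta>"
proof -
  obtain \<eta> C where \<eta>: "0 < \<eta>" "0 < C" "exp \<eta> \<le> R" and
    expo: "\<And>n s \<theta> (w :: complex). 0 < \<theta> \<Longrightarrow> real s - real n * mean X = \<theta> * var X * real s / mean X \<Longrightarrow>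
       norm w \<le> \<eta> \<Longrightarrow> \<theta> \<le> 2 * norm w \<Longrightarrow>
       (\<exists>V. pgf X (exp w) ^ n / exp w ^ s = exp (- V) \<and>
          norm (V - of_real (real s * var X / (2 * mean X)) * (w * (2 * of_real \<theta> - w))) \<le>
            real s * var X / (2 * mean X) * (C * norm w ^ 3))"
    using tilted_exponent[OF X \<mu> v] by blast
  \<comment> \<open>For \<open>|w| \<le> 1 / (2 C)\<close> the exponent differs from \<open>v = a |w|^2\<close> by at most \<open>v / 2\<close>, as the Lipschitz
      estimate for the logarithm requires.\<close>
  define \<delta> where "\<delta> = Min {\<eta>, 1 / (2 * C), 1}"
  have \<delta>: "0 < \<delta>" "\<delta> \<le> \<eta>" "\<delta> \<le> 1 / (2 * C)" "\<delta> \<le> 1" using \<eta> by (auto simp: \<delta>_def)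
  define h where "h = \<delta> / 2"
  have h: "0 < h" "h \<le> pi" using \<delta> pi_gt3 by (auto simp: h_def)
  obtain q \<theta>1 where q: "0 < q" "q < 1" "0 < \<theta>1" and
    off: "\<And>\<theta> u. 0 \<le> \<theta> \<Longrightarrow> \<theta> \<le> \<theta>1 \<Longrightarrow> h \<le> \<bar>u\<bar> \<Longrightarrow> \<bar>u\<bar> \<le> pi \<Longrightarrow> norm (pgf X (exp (Complex \<theta> u))) \<le> q"
    using pgf_bound_off_axis[OF X circle h] by blast
  obtain CK0 where CK0: "\<And>w :: complex. norm w \<le> 5 \<Longrightarrow> w \<noteq> 0 \<Longrightarrow>
      norm (exp w * (exp w + 1) / (exp w - 1) ^ 3 - 2 / w ^ 3) \<le> CK0"
    using kernel_near_pole by blast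
  define CK where "CK = max CK0 0"
  have CK: "CK \<ge> 0" "\<And>w :: complex. norm w \<le> 5 \<Longrightarrow> w \<noteq> 0 \<Longrightarrow>
      norm (exp w * (exp w + 1) / (exp w - 1) ^ 3 - 2 / w ^ 3) \<le> CK"
    using CK0 by (auto simp: CK_def intro: max.coboundedI1)
  obtain CL where CL: "\<And>g :: complex. norm g \<le> q \<Longrightarrow> norm (Ln (1 - g)) \<le> CL"
  proof -
    have "1 - g \<notin> \<real>\<^sub>\<le>\<^sub>0" if "norm g \<le> q" for g :: complex
      using that q complex_Re_le_cmod[of g] by (auto simp: complex_nonpos_Reals_iff)
    hence "continuous_on (cball 0 q) (\<lambda>g :: complex. Ln (1 - g))"
      by (intro continuous_intros) auto
    hence "bounded ((\<lambda>g :: complex. Ln (1 - g)) ` cball 0 q)"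
      by (intro compact_imp_bounded compact_continuous_image) auto
    thus ?thesis using that unfolding bounded_iff by (metis (no_types, lifting) image_eqI mem_cball_0)
  qed
  have CL0: "CL \<ge> 0" using CL[of 0] q by simp
  define a0 where "a0 = var X / (2 * mean X)"
  have a0: "a0 > 0" using \<mu> v by (simp add: a0_def)
  \<comment> \<open>The bound \<open>1 / (40 C)\<close> keeps the exponent positive at the real points between \<open>\<theta> / 2\<close> and \<open>3 \<theta> / 2\<close>, where
      the quadratic part \<open>a x (2 \<theta> - x)\<close> is at least \<open>a x \<theta> / 2\<close>.\<close>
  define \<theta>0 where "\<theta>0 = Min {\<delta> / 2, \<theta>1, 1 / (40 * C)}"
  have \<theta>0: "0 < \<theta>0" "\<theta>0 \<le> \<delta> / 2" "\<theta>0 \<le> \<theta>1" "\<theta>0 \<le> 1 / (40 * C)"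
    using \<delta> q \<eta> by (auto simp: \<theta>0_def)
  \<comment> \<open>\<open>D1\<close>, \<open>D2\<close> and \<open>2 / a0\<close> bound \<open>\<theta>\<^sup>2 + u\<^sup>2\<close> times the difference of the integrands for \<open>|u| \<le> h\<close>,
      \<open>h \<le> |u| \<le> \<pi>\<close> and \<open>|u| > \<pi>\<close>; the factor 25 in \<open>D2\<close> bounds \<open>\<theta>\<^sup>2 + u\<^sup>2\<close> itself on the middle range.\<close>
  define D1 where "D1 = CK / a0 + 2 * C * CK + 4 * C"
  define D2 where "D2 = 25 * (CL * (CK + 2 / h ^ 3) + 1 / (a0 * h\<^sup>2) * (2 / h ^ 3))"
  define D where "D = D1 + D2 + 2 / a0"
  have D12: "D1 \<ge> 0" "D2 \<ge> 0" "D \<ge> 0"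
    using CK CL0 a0 h \<eta> by (auto simp: D1_def D2_def D_def intro!: add_nonneg_nonneg mult_nonneg_nonneg divide_nonneg_nonneg)
  have main: "\<bar>var Q - 4 * \<theta> * (a * sqrt a) / pi * G3 (\<theta> * sqrt a)\<bar> \<le> (D / 2) / \<theta>"
    if n: "n \<ge> 1" and s: "s \<ge> 1" and \<theta>: "0 < \<theta>" "\<theta> \<le> \<theta>0"
      and drift: "real s - real n * mean X = \<theta> * var X * real s / mean X"
      and a_def: "a = real s * var X / (2 * mean X)"
      and Q: "Q = map_pmf (\<lambda>b. b - s) (map_pmf (\<lambda>(q, a). q + a) (pair_pmf Q (demand X n)))"
    for n s \<theta> a Q
  proof -
    have aa0: "a0 \<le> a" using s \<mu> v by (simp add: a_def a0_def divide_right_mono)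
    have a: "a > 0" using aa0 a0 by simp
    have expo': "\<exists>V. pgf X (exp w) ^ n / exp w ^ s = exp (- V) \<and>
          norm (V - of_real a * (w * (2 * of_real \<theta> - w))) \<le> a * (C * norm w ^ 3)"
      if "norm w \<le> \<eta>" "\<theta> \<le> 2 * norm w" for w :: complex
      using expo[OF \<theta>(1) drift that] by (simp add: a_def)
    \<comment> \<open>The radii \<open>exp (\<theta> / 2)\<close> and \<open>exp (3 \<theta> / 2)\<close> enclose the circle \<open>|z| = exp \<theta>\<close> of integration.\<close>
    define r0 where "r0 = exp (\<theta> / 2)"
    define r1 where "r1 = exp (3 * \<theta> / 2)"
    have \<theta>\<eta>: "3 * \<theta> / 2 \<le> \<eta>" using \<theta> \<theta>0 \<delta> by linarith
    have r1R: "r1 \<le> R" using \<theta>\<eta> \<eta>(3) unfolding r1_def by (meson exp_le_cancel_iff order.trans)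
    have X1: "summable (\<lambda>j. pmf X j * r1 ^ j)"
      using pgf_summable(2)[OF X(1), of r1] r1R by (simp add: sums_iff r1_def)
    have drift_r: "pgf (demand X n) r < r ^ s" if r: "r0 \<le> r" "r \<le> r1" for r
    proof -
      define x where "x = ln r"
      have "r0 > 0" by (simp add: r0_def)
      hence rp: "r > 0" using r by linarith
      have xr: "r = exp x" using rp by (simp add: x_def)
      have x: "\<theta> / 2 \<le> x" "x \<le> 3 * \<theta> / 2" "r = exp x"
        using r xr unfolding r0_def r1_def by (simp_all only: exp_le_cancel_iff)
      have nx: "norm (complex_of_real x) = x" using x \<theta> by simp
      obtain V where V: "pgf X (exp (of_real x)) ^ n / exp (complex_of_real x) ^ s = exp (- V)"
        "norm (V - of_real a * (of_real x * (2 * of_real \<theta> - of_real x))) \<le> a * (C * x ^ 3)"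
        using expo'[of "of_real x"] x \<theta>\<eta> unfolding nx by auto
      have "V - of_real a * (of_real x * (2 * of_real \<theta> - of_real x)) = V - of_real (a * (x * (2 * \<theta> - x)))" by simp
      hence "\<bar>Re V - a * (x * (2 * \<theta> - x))\<bar> \<le> a * (C * x ^ 3)"
        using V(2) abs_Re_le_cmod[of "V - of_real (a * (x * (2 * \<theta> - x)))"] by simp
      moreover have "a * (C * x ^ 3) < a * (x * (2 * \<theta> - x))"
      proof -
        have xp: "x > 0" using x \<theta> by linarith
        have "C * x\<^sup>2 \<le> C * (3 * \<theta> / 2)\<^sup>2" using x xp \<eta> by (intro mult_left_mono power_mono) auto
        also have "\<dots> = (9 / 4) * (C * \<theta>) * \<theta>" by (simp add: power2_eq_square)
        also have "\<dots> \<le> (9 / 4) * (1 / 40) * \<theta>"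
        proof -
          have "C * \<theta> \<le> C * (1 / (40 * C))" using \<theta> \<theta>0 \<eta> by (intro mult_left_mono) auto
          hence "C * \<theta> \<le> 1 / 40" using \<eta> by simp
          thus ?thesis using \<theta> by (intro mult_right_mono mult_left_mono) auto
        qed
        also have "\<dots> < 2 * \<theta> - x" using x \<theta> by linarith
        finally have "x * (C * x\<^sup>2) < x * (2 * \<theta> - x)" using xp by simp
        thus ?thesis using a by (simp add: power2_eq_square power3_eq_cube mult_ac)
      qed
      ultimately have "Re V > 0" by linarith
      hence "norm (exp (- V)) < 1" by simp
      hence "norm (pgf X (exp (complex_of_real x)) ^ n / exp (complex_of_real x) ^ s) < 1" using V(1) by simp
      also have "exp (complex_of_real x) = of_real r" using x(3) by (simp add: exp_of_real)
      also have "pgf X (complex_of_real r) = of_real (pgf X r)"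
        using rp r by (intro pgf_of_real[OF X1]) auto
      finally have "\<bar>pgf X r\<bar> ^ n < r ^ s" using rp by (simp add: norm_divide norm_power)
      moreover have "pgf (demand X n) r = pgf X r ^ n" using rp r by (intro pgf_demand(2)[OF X1]) (auto simp: r1_def)
      moreover have "pgf X r ^ n \<le> \<bar>pgf X r\<bar> ^ n" by (metis abs_ge_self power_abs)
      ultimately show ?thesis by linarith
    qed
    interpret lindley_annulus "demand X n" s r0 r1
    proof
      show "1 < r0" "r0 < r1" using \<theta> by (auto simp: r0_def r1_def)
      show "summable (\<lambda>j. pmf (demand X n) j * r1 ^ j)"
        by (rule pgf_demand(1)[OF X1]) (simp add: r1_def)
    qed (rule drift_r)
    define r where "r = exp \<theta>"
    have r: "r0 < r" "r < r1" using \<theta> by (auto simp: r_def r0_def r1_def)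
    define f where "f = (\<lambda>u. let z = of_real r * cis u in - Ln (1 - G z) * (z * (z + 1) / (z - 1) ^ 3))"
    define \<Lambda> where "\<Lambda> = (\<lambda>u. - ln (1 - exp (- (a * (\<theta>\<^sup>2 + u\<^sup>2)))))"
    define g where "g = (\<lambda>u. \<Lambda> u * Re (2 / Complex \<theta> u ^ 3))"
    define qq where "qq = (\<lambda>u. \<theta>\<^sup>2 + u\<^sup>2)"
    have qq: "qq u > 0" for u unfolding qq_def using \<theta> by (intro add_pos_nonneg) auto
    have nw: "(norm (Complex \<theta> u))\<^sup>2 = qq u" for u by (simp add: norm_Complex_sq qq_def)
    have wnz: "Complex \<theta> u \<noteq> 0" for u using \<theta> by (simp add: complex_eq_iff)
    have w\<theta>: "\<theta> \<le> norm (Complex \<theta> u)" "\<bar>u\<bar> \<le> norm (Complex \<theta> u)" for u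
      using abs_Re_le_cmod[of "Complex \<theta> u"] abs_Im_le_cmod[of "Complex \<theta> u"] \<theta> by simp_all
    have w_le: "norm (Complex \<theta> u) \<le> \<theta> + \<bar>u\<bar>" for u
      using cmod_le[of "Complex \<theta> u"] \<theta> by simp
    have \<Lambda>_bd: "0 \<le> \<Lambda> u" "\<Lambda> u \<le> 1 / a0 * (1 / qq u)" for u
    proof -
      have p: "a * qq u > 0" using a qq by simp
      have "1 / (a * qq u) \<le> 1 / (a0 * qq u)"
        using aa0 a0 qq[of u] by (intro divide_left_mono mult_right_mono mult_pos_pos) (auto intro: less_le_trans)
      thus "0 \<le> \<Lambda> u" "\<Lambda> u \<le> 1 / a0 * (1 / qq u)"
        using neg_ln_one_minus_exp_bounds(1,2)[OF p] by (simp_all add: \<Lambda>_def qq_def)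
    qed
    have z_eq: "of_real r * cis u = exp (Complex \<theta> u)" for u by (simp add: r_def exp_eq_polar)
    have f_eq: "f u = - Ln (1 - G (exp (Complex \<theta> u))) *
        (exp (Complex \<theta> u) * (exp (Complex \<theta> u) + 1) / (exp (Complex \<theta> u) - 1) ^ 3)" for u
      by (simp add: f_def z_eq Let_def)
    have G_eq: "G (exp (Complex \<theta> u)) = pgf X (exp (Complex \<theta> u)) ^ n / exp (Complex \<theta> u) ^ s" for u
    proof -
      have "norm (exp (Complex \<theta> u)) \<le> r1" using r by (simp add: r_def)
      from pgf_demand(2)[OF X1 _ this] show ?thesis by (simp add: G_def r1_def)
    qed
    have cube: "norm (2 / Complex \<theta> u ^ 3) = 2 / (norm (Complex \<theta> u) * qq u)" for u
    proof -
      have "norm (Complex \<theta> u) ^ 3 = norm (Complex \<theta> u) * qq u"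
        unfolding nw[symmetric] by (simp add: power2_eq_square power3_eq_cube)
      thus ?thesis by (simp add: norm_divide norm_power)
    qed
    have inner: "norm (f u - of_real (\<Lambda> u) * (2 / Complex \<theta> u ^ 3)) \<le> D1 * (1 / qq u)" if u: "\<bar>u\<bar> \<le> h" for u
    proof -
      define w where "w = Complex \<theta> u"
      define K where "K = exp w * (exp w + 1) / (exp w - 1) ^ 3"
      have w\<delta>: "norm w \<le> \<delta>" using w_le[of u] u \<theta> \<theta>0 by (simp add: w_def h_def)
      have w0: "w \<noteq> 0" "norm w > 0" using wnz by (simp_all add: w_def)
      have wsq: "norm w * norm w = qq u" using nw[of u] by (simp add: w_def power2_eq_square)
      have "w * (2 * of_real \<theta> - w) = of_real (qq u)"
        by (simp add: w_def qq_def complex_eq_iff power2_eq_square algebra_simps)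
      then obtain V where V: "G (exp w) = exp (- V)" "norm (V - of_real (a * qq u)) \<le> a * (C * norm w ^ 3)"
        using expo'[of w] w\<delta> \<delta> w\<theta>[of u] \<theta> unfolding w_def[symmetric] G_eq[of u, folded w_def] by auto
      have w3: "norm w ^ 3 = norm w * qq u" by (simp add: power3_eq_cube wsq)
      have "a * (C * norm w ^ 3) = a * qq u * (C * norm w)" by (simp add: w3)
      also have "\<dots> \<le> a * qq u * (1 / 2)"
      proof (rule mult_left_mono)
        have "C * norm w \<le> C * (1 / (2 * C))" using w\<delta> \<delta> \<eta> by (intro mult_left_mono) auto
        thus "C * norm w \<le> 1 / 2" using \<eta> by simp
      qed (use a qq[of u] in auto)
      finally have half: "norm (V - of_real (a * qq u)) \<le> a * qq u / 2" using V(2) by simp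
      have aq: "a * qq u > 0" using a qq by simp
      have "norm (Ln (1 - exp (- V)) - of_real (ln (1 - exp (- (a * qq u))))) \<le> 2 / (a * qq u) * norm (V - of_real (a * qq u))"
        by (rule Ln_one_minus_exp_lipschitz[OF aq half])
      also have "\<dots> \<le> 2 / (a * qq u) * (a * (C * norm w ^ 3))"
        using aq by (intro mult_left_mono V) auto
      also have "\<dots> = 2 * C * norm w" using aq a qq[of u] by (simp add: w3)
      also have "Ln (1 - exp (- V)) - of_real (ln (1 - exp (- (a * qq u)))) = - (- Ln (1 - G (exp w)) - of_real (\<Lambda> u))"
        by (simp add: V(1) \<Lambda>_def qq_def)
      finally have L: "norm (- Ln (1 - G (exp w)) - of_real (\<Lambda> u)) \<le> 2 * C * norm w"
        by (simp only: norm_minus_cancel)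
      have K: "norm (K - 2 / w ^ 3) \<le> CK" unfolding K_def using w\<delta> \<delta> w0 by (intro CK) auto
      have "f u - of_real (\<Lambda> u) * (2 / w ^ 3) =
          (- Ln (1 - G (exp w)) - of_real (\<Lambda> u)) * (2 / w ^ 3) + - Ln (1 - G (exp w)) * (K - 2 / w ^ 3)"
        unfolding f_eq[of u, folded w_def] K_def[symmetric] by (simp add: algebra_simps)
      hence "norm (f u - of_real (\<Lambda> u) * (2 / w ^ 3)) \<le>
          norm (- Ln (1 - G (exp w)) - of_real (\<Lambda> u)) * norm (2 / w ^ 3) + norm (- Ln (1 - G (exp w))) * norm (K - 2 / w ^ 3)"
        by (metis norm_mult norm_triangle_ineq)
      also have "norm (- Ln (1 - G (exp w)) - of_real (\<Lambda> u)) * norm (2 / w ^ 3) \<le> (2 * C * norm w) * (2 / (norm w * qq u))"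
        using L cube[of u] \<eta> less_imp_le[OF qq[of u]] by (intro mult_mono) (auto simp: w_def)
      also have "(2 * C * norm w) * (2 / (norm w * qq u)) = 4 * C * (1 / qq u)" using w0 by simp
      also have "norm (- Ln (1 - G (exp w))) * norm (K - 2 / w ^ 3) \<le> (1 / a0 * (1 / qq u) + 2 * C * norm w) * CK"
      proof (intro mult_mono K)
        have "norm (- Ln (1 - G (exp w))) \<le> norm (- Ln (1 - G (exp w)) - of_real (\<Lambda> u)) + norm (complex_of_real (\<Lambda> u))"
          using norm_triangle_sub[of "- Ln (1 - G (exp w))" "of_real (\<Lambda> u)"] by (simp only: add.commute)
        also have "norm (complex_of_real (\<Lambda> u)) = \<Lambda> u" using \<Lambda>_bd[of u] by simp
        finally show "norm (- Ln (1 - G (exp w))) \<le> 1 / a0 * (1 / qq u) + 2 * C * norm w"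
          using L \<Lambda>_bd[of u] by linarith
      qed (use a0 qq[of u] \<eta> in auto)
      also have "(1 / a0 * (1 / qq u) + 2 * C * norm w) * CK \<le> (1 / a0 * (1 / qq u) + 2 * C * (1 / qq u)) * CK"
      proof (intro mult_right_mono add_left_mono mult_left_mono)
        have w1: "norm w \<le> 1" using w\<delta> \<delta> by linarith
        have "norm w * qq u = norm w ^ 3" by (simp add: w3)
        also have "\<dots> \<le> 1 ^ 3" using w1 by (intro power_mono) auto
        finally show "norm w \<le> 1 / qq u" using qq[of u] by (simp add: field_simps)
      qed (use CK \<eta> in auto)
      finally show ?thesis unfolding w_def[symmetric] by (simp add: D1_def algebra_simps)
    qed
    have outer: "norm (f u - of_real (\<Lambda> u) * (2 / Complex \<theta> u ^ 3)) \<le> D2 * (1 / qq u)"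
      if u: "h \<le> \<bar>u\<bar>" "\<bar>u\<bar> \<le> pi" for u
    proof -
      define w where "w = Complex \<theta> u"
      define K where "K = exp w * (exp w + 1) / (exp w - 1) ^ 3"
      have w5: "norm w \<le> 5" using w_le[of u] u \<theta> \<theta>0 \<delta> pi_less_4 by (simp add: w_def)
      have wh: "h \<le> norm w" using u w\<theta>[of u] by (simp add: w_def)
      have w0: "w \<noteq> 0" using wnz by (simp add: w_def)
      have w3: "norm (2 / w ^ 3) \<le> 2 / h ^ 3"
        using wh h by (auto simp: norm_divide norm_power intro!: divide_left_mono power_mono mult_pos_pos)
      have K: "norm K \<le> CK + 2 / h ^ 3"
        using CK(2)[OF w5 w0] norm_triangle_sub[of K "2 / w ^ 3"] w3 unfolding K_def[symmetric] by linarith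
      have "norm (G (exp w)) = norm (pgf X (exp w)) ^ n / exp \<theta> ^ s"
        unfolding G_eq[of u, folded w_def] by (simp add: norm_divide norm_power w_def)
      also have "\<dots> \<le> norm (pgf X (exp w)) ^ n / 1"
        using \<theta> by (intro divide_left_mono one_le_power) auto
      also have "\<dots> \<le> q ^ n" using off[of \<theta> u] \<theta> \<theta>0 u unfolding div_by_1 by (intro power_mono) (auto simp: w_def)
      also have "\<dots> \<le> q ^ 1" using n q by (intro power_decreasing) auto
      finally have "norm (Ln (1 - G (exp w))) \<le> CL" by (intro CL) simp
      hence "norm (f u) \<le> CL * (CK + 2 / h ^ 3)"
        unfolding f_eq[of u, folded w_def] K_def[symmetric] norm_mult using K CL0 by (intro mult_mono) auto
      moreover have "norm (of_real (\<Lambda> u) * (2 / w ^ 3)) \<le> 1 / (a0 * h\<^sup>2) * (2 / h ^ 3)"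
        unfolding norm_mult
      proof (intro mult_mono w3)
        have "h\<^sup>2 \<le> \<bar>u\<bar>\<^sup>2" using u h by (intro power_mono) auto
        hence "h\<^sup>2 \<le> qq u" by (simp add: qq_def add_increasing)
        hence "1 / (a0 * qq u) \<le> 1 / (a0 * h\<^sup>2)"
          using a0 h qq[of u] by (intro divide_left_mono mult_left_mono mult_pos_pos) auto
        thus "norm (complex_of_real (\<Lambda> u)) \<le> 1 / (a0 * h\<^sup>2)" using \<Lambda>_bd[of u] by simp
      qed (use a0 in auto)
      ultimately have "norm (f u - of_real (\<Lambda> u) * (2 / w ^ 3)) \<le> D2 / 25"
        using norm_triangle_ineq4[of "f u" "of_real (\<Lambda> u) * (2 / w ^ 3)"] by (simp add: D2_def)
      also have "D2 / 25 \<le> D2 * (1 / qq u)"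
      proof -
        have "qq u \<le> 5\<^sup>2" unfolding nw[symmetric] using w5 by (intro power_mono) (auto simp: w_def)
        hence "1 / 5\<^sup>2 \<le> 1 / qq u" using qq[of u] by (intro divide_left_mono) auto
        hence "D2 * (1 / 5\<^sup>2) \<le> D2 * (1 / qq u)" using D12 by (intro mult_left_mono)
        thus ?thesis by simp
      qed
      finally show ?thesis by (simp add: w_def)
    qed
    define f1 where "f1 = (\<lambda>u. indicator {- pi..pi} u * Re (f u))"
    have diff: "norm (f1 u - g u) \<le> D * (1 / qq u)" for u
    proof -
      have in_pi: "norm (f1 u - g u) \<le> norm (f u - of_real (\<Lambda> u) * (2 / Complex \<theta> u ^ 3))" if "\<bar>u\<bar> \<le> pi"
      proof -
        have re: "Re (of_real c * y) = c * Re y" for c y by simp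
        have "f1 u = Re (f u)" using that by (simp add: f1_def abs_le_iff)
        hence "f1 u - g u = Re (f u - of_real (\<Lambda> u) * (2 / Complex \<theta> u ^ 3))"
          by (simp only: g_def minus_complex.sel re)
        thus ?thesis by (simp only: real_norm_def abs_Re_le_cmod)
      qed
      consider "\<bar>u\<bar> \<le> h" | "h \<le> \<bar>u\<bar>" "\<bar>u\<bar> \<le> pi" | "\<bar>u\<bar> > pi" by linarith
      thus ?thesis
      proof cases
        case 1
        hence "norm (f1 u - g u) \<le> D1 * (1 / qq u)" using in_pi inner[of u] h by linarith
        also have "\<dots> \<le> D * (1 / qq u)" using D12 a0 qq[of u] by (intro mult_right_mono) (auto simp: D_def)
        finally show ?thesis .
      next
        case 2
        hence "norm (f1 u - g u) \<le> D2 * (1 / qq u)" using in_pi outer[of u] by linarith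
        also have "\<dots> \<le> D * (1 / qq u)" using D12 a0 qq[of u] by (intro mult_right_mono) (auto simp: D_def)
        finally show ?thesis .
      next
        case 3
        hence "norm (f1 u - g u) = \<Lambda> u * \<bar>Re (2 / Complex \<theta> u ^ 3)\<bar>"
          using \<Lambda>_bd[of u] by (auto simp: f1_def g_def indicator_def abs_mult)
        also have "\<dots> \<le> 1 / a0 * (1 / qq u) * 2"
        proof (intro mult_mono \<Lambda>_bd)
          have "norm (Complex \<theta> u) \<ge> 1" using w\<theta>[of u] 3 pi_gt3 by linarith
          hence "1 \<le> norm (Complex \<theta> u) ^ 3" by (rule one_le_power)
          hence "norm (2 / Complex \<theta> u ^ 3) \<le> 2" by (simp add: norm_divide norm_power divide_le_eq)
          thus "\<bar>Re (2 / Complex \<theta> u ^ 3)\<bar> \<le> 2" using abs_Re_le_cmod order.trans by blast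
        qed (use a0 qq[of u] in auto)
        also have "\<dots> = 2 / a0 * (1 / qq u)" by simp
        also have "\<dots> \<le> D * (1 / qq u)" using D12 qq[of u] by (intro mult_right_mono) (auto simp: D_def)
        finally show ?thesis .
      qed
    qed
    have f_cont: "continuous_on {- pi..pi} (\<lambda>u. Re (f u))"
      unfolding f_def by (intro continuous_intros contour_integrand_continuous r)
    have f_si: "set_integrable lborel {- pi..pi} (\<lambda>u. Re (f u))"
      by (rule borel_integrable_atLeastAtMost'[OF f_cont])
    have "((\<lambda>u. Re (f u)) has_integral Re (of_real (2 * pi * var Q))) {- pi..pi}"
      unfolding f_def by (intro has_integral_Re variance_contour_integral[OF Q r])
    hence f_int: "(LBINT u. f1 u) = 2 * pi * var Q"
      using set_borel_integral_eq_integral(2)[OF f_si] by (simp add: f1_def set_lebesgue_integral_def integral_unique)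
    have f1_i: "integrable lborel f1" using f_si by (simp add: f1_def set_integrable_def)
    have g_i: "integrable lborel g"
      "(LBINT u. g u) = 8 * \<theta> * (a * sqrt a) * G3 (\<theta> * sqrt a)"
      unfolding g_def \<Lambda>_def by (rule gaussian_main_term[OF a \<theta>(1)])+
    have D_i: "integrable lborel (\<lambda>u. D * (1 / qq u))" "(LBINT u. D * (1 / qq u)) = D * (pi / \<theta>)"
      unfolding qq_def using integral_inverse_quadratic[OF \<theta>(1)] by (auto intro!: integrable_mult_right simp del: times_divide_eq_right)
    have "\<bar>2 * pi * var Q - 8 * \<theta> * (a * sqrt a) * G3 (\<theta> * sqrt a)\<bar> = norm (LBINT u. f1 u - g u)"
      using f1_i g_i f_int by simp
    also have "\<dots> \<le> (LBINT u. D * (1 / qq u))"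
      by (rule Bochner_Integration.integral_norm_bound_integral) (use f1_i g_i D_i diff in auto)
    finally have *: "\<bar>2 * pi * var Q - 8 * \<theta> * (a * sqrt a) * G3 (\<theta> * sqrt a)\<bar> \<le> D * (pi / \<theta>)" using D_i by simp
    have "2 * pi * \<bar>var Q - 4 * \<theta> * (a * sqrt a) / pi * G3 (\<theta> * sqrt a)\<bar> =
          \<bar>2 * pi * var Q - 8 * \<theta> * (a * sqrt a) * G3 (\<theta> * sqrt a)\<bar>"
    proof -
      have "2 * pi * (var Q - 4 * \<theta> * (a * sqrt a) / pi * G3 (\<theta> * sqrt a)) =
            2 * pi * var Q - 8 * \<theta> * (a * sqrt a) * G3 (\<theta> * sqrt a)"
        by (simp add: right_diff_distrib)
      moreover have "2 * pi * \<bar>x\<bar> = \<bar>2 * pi * x\<bar>" for x :: real by (simp add: abs_mult)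
      ultimately show ?thesis by (simp only:)
    qed
    with * have "2 * pi * \<bar>var Q - 4 * \<theta> * (a * sqrt a) / pi * G3 (\<theta> * sqrt a)\<bar> \<le> 2 * pi * ((D / 2) / \<theta>)" by (simp add: mult.commute)
    thus ?thesis by (subst (asm) mult_le_cancel_left_pos) auto
  qed
  show thesis
    by (rule that[of \<theta>0 "D / 2"]) (use main \<theta>0(1) D12(3) in blast | simp)+
qed

section \<open>Many-server heavy-traffic scaling\<close>

theorem theorem5:
  fixes X :: "nat pmf" and \<alpha> :: real
    and s n :: "nat \<Rightarrow> nat" and \<gamma> :: "nat \<Rightarrow> real" and Q :: "nat \<Rightarrow> nat pmf"
  defines "\<mu> \<equiv> mean X" and "\<sigma> \<equiv> sqrt (var X)"
  defines "d \<equiv> \<lambda>k. sqrt (real (s k) powr (1 - 2 * \<alpha>) * (\<gamma> k)\<^sup>2 * \<mu> / (2 * \<sigma>\<^sup>2))"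
  assumes radius: "pgf_radius X > 1"
    and mean_pos: "\<mu> > 0"
    and max_modulus: "\<And>(r1::real) (z::complex).
          0 < r1 \<Longrightarrow> ereal r1 < pgf_radius X \<Longrightarrow> cmod z = r1 \<Longrightarrow> z \<noteq> of_real r1 \<Longrightarrow>
          cmod (pgf X z) < pgf X r1"
    and alpha: "1 / 2 \<le> \<alpha>" "\<alpha> < 1"
    and pos: "\<And>k. s k > 0" "\<And>k. n k > 0"
    and s_lim: "filterlim s at_top sequentially"
    and stable: "\<And>k. 0 < real (n k) * \<mu>" "\<And>k. real (n k) * \<mu> < real (s k)"
    and overflow: "\<And>k. \<exists>j > s k. pmf (demand X (n k)) j > 0"
    and gamma_pos: "\<And>k. \<gamma> k > 0"
    and gamma_bounded: "\<exists>c C. 0 < c \<and> (\<forall>\<^sub>F k in sequentially. c \<le> \<gamma> k \<and> \<gamma> k \<le> C)"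
    and scaling: "\<And>k. real (n k) * \<mu> / real (s k) = 1 - \<gamma> k / real (s k) powr \<alpha>"
    and stationary: "\<And>k. stationary_distribution (congestion_kernel X (n k) (s k)) (Q k)"
  shows "\<exists>\<epsilon> :: nat \<Rightarrow> real.
           \<epsilon> \<in> O(\<lambda>k. real (s k) powr (\<alpha> - 1)) \<and>
           (\<forall>k. var (Q k) =
                  \<gamma> k * \<sigma> / pi * sqrt (2 / \<mu>) * real (s k) powr (3 / 2 - \<alpha>) * G3 (d k) *
                  (1 + \<epsilon> k))"
proof -
  obtain R where R: "1 < R" "ereal R < pgf_radius X"
    using ereal_dense2[OF radius] by (auto simp: one_ereal_def)
  have sX: "summable (\<lambda>j. pmf X j * R ^ j)"
    using R by (intro summable_in_conv_radius) (auto simp: pgf_radius_def)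
  have circle: "norm (pgf X z) < 1" if "norm z = 1" "z \<noteq> 1" for z :: complex
    using max_modulus[of 1 z] that radius by (simp add: one_ereal_def)
  have v: "var X > 0" by (rule variance_pos[OF sX R(1) circle]) auto
  have \<sigma>: "\<sigma> > 0" "\<sigma>\<^sup>2 = var X" using v by (auto simp: \<sigma>_def)
  obtain \<theta>0 D where \<theta>0: "0 < \<theta>0" "0 \<le> D"
    and uniform: "\<And>n s \<theta> a Q. n \<ge> 1 \<Longrightarrow> s \<ge> 1 \<Longrightarrow> 0 < \<theta> \<Longrightarrow> \<theta> \<le> \<theta>0 \<Longrightarrow>
      real s - real n * mean X = \<theta> * var X * real s / mean X \<Longrightarrow>
      a = real s * var X / (2 * mean X) \<Longrightarrow>
      Q = map_pmf (\<lambda>b. b - s) (map_pmf (\<lambda>(q, a). q + a) (pair_pmf Q (demand X n))) \<Longrightarrow>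
      \<bar>var Q - 4 * \<theta> * (a * sqrt a) / pi * G3 (\<theta> * sqrt a)\<bar> \<le> D / \<theta>"
  proof (rule uniform_heavy_traffic[OF sX R(1) mean_pos[unfolded \<mu>_def] v circle], goal_cases)
    case (3 \<theta>0 D)
    from that[OF 3(2-4)] show ?case .
  qed
  obtain C where C: "eventually (\<lambda>k. \<gamma> k \<le> C) sequentially"
  proof -
    obtain c0 C where "eventually (\<lambda>k. c0 \<le> \<gamma> k \<and> \<gamma> k \<le> C) sequentially"
      using gamma_bounded by blast
    hence "eventually (\<lambda>k. \<gamma> k \<le> C) sequentially" by (rule eventually_mono) simp
    thus ?thesis by (rule that)
  qed
  define \<theta> where "\<theta> = (\<lambda>k. \<mu> * \<gamma> k / (\<sigma>\<^sup>2 * real (s k) powr \<alpha>))"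
  define a where "a = (\<lambda>k. real (s k) * \<sigma>\<^sup>2 / (2 * \<mu>))"
  define M where "M = (\<lambda>k. \<gamma> k * \<sigma> / pi * sqrt (2 / \<mu>) * real (s k) powr (3 / 2 - \<alpha>) * G3 (d k))"
  have sp: "real (s k) \<ge> 1" for k using pos(1)[of k] by linarith
  have s0: "real (s k) > 0" for k using sp[of k] by linarith
  have \<theta>: "\<theta> k > 0" for k using gamma_pos[of k] mean_pos \<sigma>(1) s0[of k] by (simp add: \<theta>_def)
  have a: "a k > 0" for k using mean_pos \<sigma>(1) s0[of k] by (simp add: a_def)
  have d_eq: "d k = \<theta> k * sqrt (a k)" for k
  proof -
    have "real (s k) powr (1 - 2 * \<alpha>) = real (s k) / (real (s k) powr \<alpha>)\<^sup>2"
    proof -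
      have "(real (s k) powr \<alpha>)\<^sup>2 = real (s k) powr (\<alpha> + \<alpha>)"
        by (simp only: powr_add power2_eq_square)
      moreover have "real (s k) powr (1 - 2 * \<alpha>) = real (s k) powr 1 / real (s k) powr (\<alpha> + \<alpha>)"
        by (simp only: mult_2 powr_diff)
      ultimately show ?thesis using s0[of k] by simp
    qed
    hence "real (s k) powr (1 - 2 * \<alpha>) * (\<gamma> k)\<^sup>2 * \<mu> / (2 * \<sigma>\<^sup>2) = (\<theta> k)\<^sup>2 * a k"
    proof -
      have alg: "S / P\<^sup>2 * g\<^sup>2 * m / (2 * t) = (m * g / (t * P))\<^sup>2 * (S * t / (2 * m))"
        if "m > 0" "t > 0" "P > 0" for S P g m t :: real
        using that by (simp add: power2_eq_square mult_ac)
      have "real (s k) powr \<alpha> > 0" "\<sigma>\<^sup>2 > 0" using s0[of k] \<sigma>(1) by simp_all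
      from alg[OF mean_pos this(2,1)]
      show ?thesis unfolding \<theta>_def a_def \<open>real (s k) powr (1 - 2 * \<alpha>) = _\<close> by blast
    qed
    hence "d k = sqrt ((\<theta> k)\<^sup>2 * a k)" by (simp add: d_def)
    thus ?thesis using \<theta>[of k] by (simp add: real_sqrt_mult)
  qed
  have M_eq: "M k = 4 * \<theta> k * (a k * sqrt (a k)) / pi * G3 (\<theta> k * sqrt (a k))" for k
  proof -
    have "real (s k) powr (3 / 2 - \<alpha>) = real (s k) * sqrt (real (s k)) / real (s k) powr \<alpha>"
    proof -
      have "real (s k) powr (3 / 2 - \<alpha>) = real (s k) powr (1 + 1 / 2) / real (s k) powr \<alpha>"
        unfolding powr_diff[symmetric] by simp
      also have "real (s k) powr (1 + 1 / 2) = real (s k) * sqrt (real (s k))"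
        using s0[of k] by (subst powr_add) (simp add: powr_half_sqrt)
      finally show ?thesis .
    qed
    note powr_eq = this
    have sqrt_a: "sqrt (a k) = sqrt (real (s k)) * \<sigma> * sqrt (2 / \<mu>) / 2"
    proof -
      have "sqrt (2 / \<mu>) / 2 = sqrt (2 / \<mu> / 4)"
        by (simp only: real_sqrt_divide[of "2 / \<mu>" 4] real_sqrt_four)
      also have "2 / \<mu> / 4 = 1 / (2 * \<mu>)" by simp
      finally have half: "sqrt (2 / \<mu>) / 2 = sqrt (1 / (2 * \<mu>))" .
      have "sqrt (a k) = sqrt (real (s k) * \<sigma>\<^sup>2 * (1 / (2 * \<mu>)))" by (simp add: a_def)
      also have "\<dots> = sqrt (real (s k)) * sqrt (\<sigma>\<^sup>2) * (sqrt (2 / \<mu>) / 2)"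
        by (simp only: real_sqrt_mult half)
      also have "sqrt (\<sigma>\<^sup>2) = \<sigma>" using \<sigma>(1) by simp
      finally show ?thesis by simp
    qed
    have alg: "g * x / pi * w * (S * q / P) * H = 4 * (m * g / (t * P)) * (S * t / (2 * m) * (q * x * w / 2)) / pi * H"
      if "m > 0" "t > 0" "P > 0" for S P g m t x w q H :: real
      using that by (simp add: mult_ac)
    define H where "H = G3 (\<theta> k * sqrt (a k))"
    have p: "real (s k) powr \<alpha> > 0" "\<sigma>\<^sup>2 > 0" using s0[of k] \<sigma>(1) by simp_all
    have th: "\<theta> k = \<mu> * \<gamma> k / (\<sigma>\<^sup>2 * real (s k) powr \<alpha>)" and ak: "a k = real (s k) * \<sigma>\<^sup>2 / (2 * \<mu>)"
      by (simp_all add: \<theta>_def a_def)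
    have "M k = \<gamma> k * \<sigma> / pi * sqrt (2 / \<mu>) * (real (s k) * sqrt (real (s k)) / real (s k) powr \<alpha>) * H"
      by (simp only: M_def d_eq H_def powr_eq)
    also have "\<dots> = 4 * \<theta> k * (a k * sqrt (a k)) / pi * H"
      unfolding alg[OF mean_pos p(2,1)] sqrt_a unfolding th ak by (rule refl)
    finally show ?thesis by (simp only: H_def)
  qed
  have G3_pos: "G3 (\<theta> k * sqrt (a k)) > 0" for k
  proof -
    have "\<theta> k * sqrt (a k) > 0" using \<theta> a by simp
    from G3_lower_bound[OF this order_refl] this show ?thesis
      by (intro less_le_trans[OF _ G3_lower_bound[OF _ order_refl]]) auto
  qed
  have M_pos: "M k > 0" for k unfolding M_eq using \<theta>[of k] a[of k] G3_pos[of k] by simp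
  \<comment> \<open>The leading term is positive for every \<open>k\<close>, so the relative error is defined for every \<open>k\<close>.\<close>
  define \<epsilon> where "\<epsilon> = (\<lambda>k. var (Q k) / M k - 1)"
  have var_eq: "var (Q k) = M k * (1 + \<epsilon> k)" for k
    using M_pos[of k] by (simp add: \<epsilon>_def)
  have close: "\<bar>var (Q k) - M k\<bar> \<le> D / \<theta> k" if "\<theta> k \<le> \<theta>0" for k
    unfolding M_eq
  proof (rule uniform[folded \<mu>_def \<sigma>(2), OF _ _ \<theta> that])
    have "real (n k) * \<mu> = real (s k) * (1 - \<gamma> k / real (s k) powr \<alpha>)"
      using scaling[of k] s0[of k] by (simp add: field_simps)
    thus "real (s k) - real (n k) * \<mu> = \<theta> k * \<sigma>\<^sup>2 * real (s k) / \<mu>"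
      using mean_pos \<sigma>(1) s0[of k] by (simp add: \<theta>_def right_diff_distrib)
    show "Q k = map_pmf (\<lambda>b. b - s k) (map_pmf (\<lambda>(q, a). q + a) (pair_pmf (Q k) (demand X (n k))))"
      by (rule stationary_congestion_lindley[OF stationary])
  qed (use pos[of k] in \<open>auto simp: a_def\<close>)
  \<comment> \<open>\<open>B\<close> bounds \<open>d\<close>, because \<open>s powr (1 - 2 * \<alpha>) \<le> 1\<close> for \<open>\<alpha> \<ge> 1 / 2\<close>.\<close>
  define B where "B = sqrt (C\<^sup>2 * \<mu> / (2 * \<sigma>\<^sup>2))"
  define c where "c = exp (- 2 * B\<^sup>2) / (16 * pi)"
  have c: "c > 0" by (simp add: c_def)
  have M_lower: "c / (\<theta> k)\<^sup>2 \<le> M k" if "\<gamma> k \<le> C" for k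
  proof -
    define b where "b = \<theta> k * sqrt (a k)"
    have b: "b > 0" using \<theta> a by (simp add: b_def)
    have "real (s k) powr (1 - 2 * \<alpha>) \<le> real (s k) powr 0" using sp[of k] alpha by (intro powr_mono) auto
    hence "real (s k) powr (1 - 2 * \<alpha>) \<le> 1" using s0[of k] by simp
    moreover have "(\<gamma> k)\<^sup>2 \<le> C\<^sup>2" using that gamma_pos[of k] by (intro power_mono) auto
    ultimately have "real (s k) powr (1 - 2 * \<alpha>) * (\<gamma> k)\<^sup>2 \<le> 1 * C\<^sup>2" by (intro mult_mono) auto
    hence "d k \<le> B" unfolding d_def B_def using mean_pos by (intro real_sqrt_le_mono divide_right_mono mult_right_mono) auto
    hence "exp (- 2 * B\<^sup>2) / (64 * b ^ 3) \<le> G3 b" using b by (intro G3_lower_bound) (auto simp: b_def d_eq)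
    hence "4 * \<theta> k * (a k * sqrt (a k)) / pi * (exp (- 2 * B\<^sup>2) / (64 * b ^ 3)) \<le> M k"
      unfolding M_eq b_def[symmetric] using \<theta>[of k] a[of k] by (intro mult_left_mono) auto
    moreover have "4 * \<theta> k * (a k * sqrt (a k)) / pi * (exp (- 2 * B\<^sup>2) / (64 * b ^ 3)) = c / (\<theta> k)\<^sup>2"
    proof -
      define w where "w = \<theta> k * (a k * sqrt (a k))"
      have w: "w > 0" using \<theta>[of k] a[of k] by (simp add: w_def)
      have cube: "(x * y) ^ 3 = x\<^sup>2 * (x * (y * y * y))" for x y :: real
        by (simp add: power3_eq_cube power2_eq_square)
      have "sqrt (a k) * sqrt (a k) = a k" using a[of k] by simp
      hence b3: "b ^ 3 = (\<theta> k)\<^sup>2 * w" by (simp only: b_def w_def cube)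
      have "4 * \<theta> k * (a k * sqrt (a k)) / pi * (exp (- 2 * B\<^sup>2) / (64 * b ^ 3)) =
            4 * w / pi * (exp (- 2 * B\<^sup>2) / (64 * ((\<theta> k)\<^sup>2 * w)))"
        by (simp only: b3 w_def mult.assoc)
      also have "\<dots> = c / (\<theta> k)\<^sup>2"
      proof -
        have alg: "4 * w / p * (E / (64 * (q * w))) = E / (16 * p) / q" for p E q :: real using w by simp
        show ?thesis unfolding c_def by (rule alg)
      qed
      finally show ?thesis .
    qed
    ultimately show ?thesis by (simp only:)
  qed
  have \<epsilon>_le: "\<bar>\<epsilon> k\<bar> \<le> D / c * \<theta> k" if "\<theta> k \<le> \<theta>0" "\<gamma> k \<le> C" for k
  proof -
    have "\<bar>\<epsilon> k\<bar> = \<bar>var (Q k) - M k\<bar> / M k"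
    proof -
      have "\<epsilon> k = (var (Q k) - M k) / M k" using M_pos[of k] by (simp add: \<epsilon>_def diff_divide_distrib)
      thus ?thesis using M_pos[of k] by (simp only: abs_divide abs_of_pos)
    qed
    also have "\<dots> \<le> (D / \<theta> k) / (c / (\<theta> k)\<^sup>2)"
      using close[OF that(1)] M_lower[OF that(2)] c \<theta>[of k] \<theta>0 by (intro frac_le) auto
    also have "\<dots> = D / c * \<theta> k" using \<theta>[of k] c by (simp add: power2_eq_square)
    finally show ?thesis .
  qed
  have \<theta>_le: "\<theta> k \<le> \<mu> * C / \<sigma>\<^sup>2 * real (s k) powr (- \<alpha>)" if "\<gamma> k \<le> C" for k
    using that mean_pos s0[of k] by (auto simp: \<theta>_def powr_minus divide_inverse intro!: mult_right_mono mult_left_mono)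
  have "filterlim (\<lambda>k. real (s k)) at_top sequentially"
    by (rule filterlim_compose[OF filterlim_real_sequentially s_lim])
  hence "((\<lambda>k. real (s k) powr (- \<alpha>)) \<longlongrightarrow> 0) sequentially"
    using alpha by (intro tendsto_neg_powr) auto
  hence "((\<lambda>k. \<mu> * C / \<sigma>\<^sup>2 * real (s k) powr (- \<alpha>)) \<longlongrightarrow> 0) sequentially"
    by (rule tendsto_mult_right_zero)
  hence "eventually (\<lambda>k. \<mu> * C / \<sigma>\<^sup>2 * real (s k) powr (- \<alpha>) < \<theta>0) sequentially"
    using \<theta>0(1) by (rule order_tendstoD)
  hence "eventually (\<lambda>k. norm (\<epsilon> k) \<le> (D / c * (\<mu> * C / \<sigma>\<^sup>2)) * norm (real (s k) powr (\<alpha> - 1))) sequentially"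
    using C
  proof eventually_elim
    case (elim k)
    have "C \<ge> 0" using elim(2) gamma_pos[of k] by simp
    have "\<bar>\<epsilon> k\<bar> \<le> D / c * \<theta> k" using \<theta>_le[OF elim(2)] elim by (intro \<epsilon>_le) auto
    also have "\<dots> \<le> D / c * (\<mu> * C / \<sigma>\<^sup>2 * real (s k) powr (- \<alpha>))"
      using \<theta>_le[OF elim(2)] \<theta>0 c by (intro mult_left_mono) auto
    also have "\<dots> \<le> D / c * (\<mu> * C / \<sigma>\<^sup>2 * real (s k) powr (\<alpha> - 1))"
      using \<theta>0 c \<open>C \<ge> 0\<close> mean_pos alpha sp[of k] by (intro mult_left_mono powr_mono) auto
    finally show ?case by simp
  qed
  hence "\<epsilon> \<in> O(\<lambda>k. real (s k) powr (\<alpha> - 1))" by (rule bigoI)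
  thus ?thesis using var_eq unfolding M_def by blast
qed

end
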